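(* There exist instances of many $p$-objective combinatorial optimization problems, including the multiobjective versions of shortest path, minimum spanning tree, assignment, minimum $s$-$t$-cut, knapsack, and traveling salesman, that do not admit a polynomial-cardinality quasi-$k$-exact $(1+\varepsilon)$-approximation set for any $k>\lceil\frac p2\rceil$ and any $\varepsilon>0$.
   Context: An instance $(X,f)$ of a $p$-objective optimization problem ($p\ge2$ a constant) consists of a set $X$ of feasible solutions and a vector $f=(f_1,\dots,f_p)$ of objective functions $f_i:X\to\mathbb{Q}_{>0}$. Definitions are stated for minimization of all objectives; they are adapted in the straightforward way if objectives are to be maximized (as for knapsack), i.e., "$f_i(x)\le\alpha_i f_i(x')$" is replaced by "$f_i(x)\ge\frac1{\alpha_i}f_i(x')$". The multiobjective version of each named problem has the feasible set of the usual single-objective problem and $p$ objective functions, each of the usual form (total cost, weight, capacity or profit with respect to its own coefficients). Quasi-$k$-exact $(1+\varepsilon)$-dominance, for an integer $k\le p$: $x\preceq_\varepsilon^{(k)}x'$ iff there is a set $S\subseteq\{1,\dots,p\}$ with $|S|=k$ (possibly depending on $x,x'$) such that $f_i(x)\le f_i(x')$ for $i\in S$ and $f_i(x)\le(1+\varepsilon)\cdot f_i(x')$ for $i\notin S$. A quasi-$k$-exact $(1+\varepsilon)$-approximation set is a set $P\subseteq X$ such that for every $x'\in X$ there is $x\in P$ with $x\preceq_\varepsilon^{(k)}x'$. "Polynomial-cardinality" means that the cardinality is bounded by a polynomial in the encoding size of the instance; as usual, non-existence is understood with respect to families of instances of growing encoding size. *)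

theory Defs
  imports
    "HOL-Computational_Algebra.Polynomial"
    "HOL-Combinatorics.Permutations"
    "HOL-Library.Log_Nat"
    "Graph_Theory.Pair_Digraph"
begin

section \<open>Multiobjective problems and quasi-exact approximation sets\<close>

datatype sense = Minimize | Maximize

fun approx_better :: "sense \<Rightarrow> real \<Rightarrow> rat \<Rightarrow> rat \<Rightarrow> bool" where
  "approx_better Minimize \<alpha> a b \<longleftrightarrow> real_of_rat a \<le> \<alpha> * real_of_rat b"
| "approx_better Maximize \<alpha> a b \<longleftrightarrow> real_of_rat a \<ge> 1 / \<alpha> * real_of_rat b"

definition quasi_dominates ::
  "sense \<Rightarrow> nat \<Rightarrow> nat \<Rightarrow> real \<Rightarrow> (nat \<Rightarrow> 'x \<Rightarrow> rat) \<Rightarrow> 'x \<Rightarrow> 'x \<Rightarrow> bool" where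
  "quasi_dominates \<sigma> p k \<epsilon> f x x' \<longleftrightarrow>
     (\<exists>S. S \<subseteq> {1..p} \<and> card S = k \<and>
          (\<forall>i\<in>S. approx_better \<sigma> 1 (f i x) (f i x')) \<and>
          (\<forall>i\<in>{1..p} - S. approx_better \<sigma> (1 + \<epsilon>) (f i x) (f i x')))"

definition quasi_exact_approx_set ::
  "sense \<Rightarrow> nat \<Rightarrow> nat \<Rightarrow> real \<Rightarrow> 'x set \<Rightarrow> (nat \<Rightarrow> 'x \<Rightarrow> rat) \<Rightarrow> 'x set \<Rightarrow> bool" where
  "quasi_exact_approx_set \<sigma> p k \<epsilon> X f P \<longleftrightarrow>
     P \<subseteq> X \<and> (\<forall>x'\<in>X. \<exists>x\<in>P. quasi_dominates \<sigma> p k \<epsilon> f x x')"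

text \<open>
  An element of \<open>'i\<close> is the input data of a problem, which for the number \<open>p\<close> of objectives
  determines the pair \<open>(X, f)\<close> of feasible set and objective functions \<open>f 1, \<dots>, f p\<close>
  (values \<open>f i\<close> for other indices \<open>i\<close> are irrelevant), and which has an encoding size.
\<close>

record ('i, 'x) mo_problem =
  sense :: sense
  instances :: "nat \<Rightarrow> 'i set"
  feasible :: "'i \<Rightarrow> 'x set"
  objective :: "'i \<Rightarrow> nat \<Rightarrow> 'x \<Rightarrow> rat"
  enc_size :: "nat \<Rightarrow> 'i \<Rightarrow> nat"

definition instance_family :: "('i, 'x) mo_problem \<Rightarrow> nat \<Rightarrow> (nat \<Rightarrow> 'i) \<Rightarrow> bool" where
  "instance_family pb p I \<longleftrightarrow>
     (\<forall>n. I n \<in> instances pb p \<and>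
          (\<forall>x\<in>feasible pb (I n). \<forall>i\<in>{1..p}. objective pb (I n) i x > 0)) \<and>
     filterlim (\<lambda>n. enc_size pb p (I n)) at_top sequentially"

definition admits_poly_card_approx ::
  "('i, 'x) mo_problem \<Rightarrow> nat \<Rightarrow> nat \<Rightarrow> real \<Rightarrow> (nat \<Rightarrow> 'i) \<Rightarrow> bool" where
  "admits_poly_card_approx pb p k \<epsilon> I \<longleftrightarrow>
     (\<exists>q :: real poly. \<forall>n. \<exists>P.
        quasi_exact_approx_set (sense pb) p k \<epsilon> (feasible pb (I n)) (objective pb (I n)) P \<and>
        finite P \<and> real (card P) \<le> poly q (real (enc_size pb p (I n))))"

section \<open>Encoding sizes\<close>

text \<open>
  Rationals are encoded in binary, as sign, numerator and denominator; graphs contribute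
  their numbers of vertices and edges, which agrees with the length of an explicit encoding up to
  a polynomial.
\<close>

definition rat_bits :: "rat \<Rightarrow> nat" where
  "rat_bits r = (case quotient_of r of (a, b) \<Rightarrow> 1 + nat (bitlen \<bar>a\<bar>) + nat (bitlen b))"

definition coeff_bits :: "nat \<Rightarrow> 'e set \<Rightarrow> (nat \<Rightarrow> 'e \<Rightarrow> rat) \<Rightarrow> nat" where
  "coeff_bits p E c = (\<Sum>i\<in>{1..p}. \<Sum>e\<in>E. rat_bits (c i e))"

definition nonneg_coeffs :: "nat \<Rightarrow> 'e set \<Rightarrow> (nat \<Rightarrow> 'e \<Rightarrow> rat) \<Rightarrow> bool" where
  "nonneg_coeffs p E c \<longleftrightarrow> (\<forall>i\<in>{1..p}. \<forall>e\<in>E. c i e \<ge> 0)"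

section \<open>Problems on directed networks\<close>

record network =
  net_graph :: "nat pair_pre_digraph"
  net_source :: nat
  net_target :: nat
  net_coeff :: "nat \<Rightarrow> nat \<times> nat \<Rightarrow> rat"

definition networks :: "nat \<Rightarrow> network set" where
  "networks p = {N. pair_digraph (net_graph N) \<and>
     net_source N \<in> pverts (net_graph N) \<and> net_target N \<in> pverts (net_graph N) \<and>
     net_source N \<noteq> net_target N \<and> nonneg_coeffs p (parcs (net_graph N)) (net_coeff N)}"

definition network_size :: "nat \<Rightarrow> network \<Rightarrow> nat" where
  "network_size p N = card (pverts (net_graph N)) + card (parcs (net_graph N))
     + coeff_bits p (parcs (net_graph N)) (net_coeff N)"

definition shortest_path :: "(network, (nat \<times> nat) list) mo_problem" where
  "shortest_path = \<lparr>
     sense = Minimize,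
     instances = networks,
     feasible = (\<lambda>N. {P. pre_digraph.apath (with_proj (net_graph N)) (net_source N) P (net_target N)}),
     objective = (\<lambda>N i P. \<Sum>e\<leftarrow>P. net_coeff N i e),
     enc_size = network_size \<rparr>"

text \<open>A cut is represented by its source side \<open>S\<close>.\<close>

definition min_st_cut :: "(network, nat set) mo_problem" where
  "min_st_cut = \<lparr>
     sense = Minimize,
     instances = networks,
     feasible = (\<lambda>N. {S. S \<subseteq> pverts (net_graph N) \<and> net_source N \<in> S \<and> net_target N \<notin> S}),
     objective = (\<lambda>N i S. \<Sum>e\<in>{e \<in> parcs (net_graph N). fst e \<in> S \<and> snd e \<notin> S}. net_coeff N i e),
     enc_size = network_size \<rparr>"

section \<open>Problems on undirected graphs\<close>

text \<open>
  Undirected edges are two-element vertex sets.  The predicates \<open>forest\<close> and \<open>tree\<close> of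
  \<open>Graph_Theory\<close> cannot be used here: they exclude exactly the directed cycles, and these
  include \<open>u, v, u\<close> in a symmetric digraph.
\<close>

definition all_edges :: "nat set \<Rightarrow> nat set set" where
  "all_edges V = {e. e \<subseteq> V \<and> card e = 2}"

definition cycle_edges :: "nat list \<Rightarrow> nat set set" where
  "cycle_edges vs = {{vs ! i, vs ! (Suc i mod length vs)} | i. i < length vs}"

definition acyclic_edges :: "nat set set \<Rightarrow> bool" where
  "acyclic_edges T \<longleftrightarrow> \<not> (\<exists>vs. length vs \<ge> 3 \<and> distinct vs \<and> cycle_edges vs \<subseteq> T)"

definition connects :: "nat set \<Rightarrow> nat set set \<Rightarrow> bool" where
  "connects V T \<longleftrightarrow> (\<forall>u\<in>V. \<forall>v\<in>V. (u, v) \<in> {(x, y). {x, y} \<in> T}\<^sup>*)"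

record edge_weighted_graph =
  ew_verts :: "nat set"
  ew_edges :: "nat set set"
  ew_cost :: "nat \<Rightarrow> nat set \<Rightarrow> rat"

definition minimum_spanning_tree :: "(edge_weighted_graph, nat set set) mo_problem" where
  "minimum_spanning_tree = \<lparr>
     sense = Minimize,
     instances = (\<lambda>p. {G. finite (ew_verts G) \<and> ew_verts G \<noteq> {} \<and>
        ew_edges G \<subseteq> all_edges (ew_verts G) \<and> nonneg_coeffs p (ew_edges G) (ew_cost G)}),
     feasible = (\<lambda>G. {T. T \<subseteq> ew_edges G \<and> connects (ew_verts G) T \<and> acyclic_edges T}),
     objective = (\<lambda>G i T. \<Sum>e\<in>T. ew_cost G i e),
     enc_size = (\<lambda>p G. card (ew_verts G) + card (ew_edges G)
        + coeff_bits p (ew_edges G) (ew_cost G)) \<rparr>"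

text \<open>Symmetric version on the complete graph with vertices \<open>0, \<dots>, n - 1\<close>; tours are edge sets
  of Hamiltonian cycles.\<close>

record tsp_instance =
  tsp_n :: nat
  tsp_cost :: "nat \<Rightarrow> nat set \<Rightarrow> rat"

definition traveling_salesman :: "(tsp_instance, nat set set) mo_problem" where
  "traveling_salesman = \<lparr>
     sense = Minimize,
     instances = (\<lambda>p. {D. tsp_n D \<ge> 3 \<and> nonneg_coeffs p (all_edges {..<tsp_n D}) (tsp_cost D)}),
     feasible = (\<lambda>D. {cycle_edges vs | vs. distinct vs \<and> set vs = {..<tsp_n D}}),
     objective = (\<lambda>D i T. \<Sum>e\<in>T. tsp_cost D i e),
     enc_size = (\<lambda>p D. tsp_n D + coeff_bits p (all_edges {..<tsp_n D}) (tsp_cost D)) \<rparr>"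

section \<open>Assignment and knapsack\<close>

record assignment_instance =
  asg_n :: nat
  asg_cost :: "nat \<Rightarrow> nat \<times> nat \<Rightarrow> rat"

definition assignment :: "(assignment_instance, nat \<Rightarrow> nat) mo_problem" where
  "assignment = \<lparr>
     sense = Minimize,
     instances = (\<lambda>p. {A. asg_n A \<ge> 1 \<and>
        nonneg_coeffs p ({..<asg_n A} \<times> {..<asg_n A}) (asg_cost A)}),
     feasible = (\<lambda>A. {\<pi>. \<pi> permutes {..<asg_n A}}),
     objective = (\<lambda>A i \<pi>. \<Sum>j<asg_n A. asg_cost A i (j, \<pi> j)),
     enc_size = (\<lambda>p A. asg_n A + coeff_bits p ({..<asg_n A} \<times> {..<asg_n A}) (asg_cost A)) \<rparr>"

record knapsack_instance =
  kp_n :: nat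
  kp_weight :: "nat \<Rightarrow> rat"
  kp_capacity :: rat
  kp_profit :: "nat \<Rightarrow> nat \<Rightarrow> rat"

definition knapsack :: "(knapsack_instance, nat set) mo_problem" where
  "knapsack = \<lparr>
     sense = Maximize,
     instances = (\<lambda>p. {K. (\<forall>j<kp_n K. kp_weight K j \<ge> 0) \<and> kp_capacity K \<ge> 0 \<and>
        nonneg_coeffs p {..<kp_n K} (kp_profit K)}),
     feasible = (\<lambda>K. {A. A \<subseteq> {..<kp_n K} \<and> (\<Sum>j\<in>A. kp_weight K j) \<le> kp_capacity K}),
     objective = (\<lambda>K i A. \<Sum>j\<in>A. kp_profit K i j),
     enc_size = (\<lambda>p K. kp_n K + (\<Sum>j<kp_n K. rat_bits (kp_weight K j)) + rat_bits (kp_capacity K)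
        + coeff_bits p {..<kp_n K} (kp_profit K)) \<rparr>"

text \<open>
  The empty packing has profit 0, so objective functions with positive values exist only on
  the nonempty packings.
\<close>

definition nonempty_knapsack :: "(knapsack_instance, nat set) mo_problem" where
  "nonempty_knapsack = knapsack\<lparr> feasible := (\<lambda>K. feasible knapsack K - {{}}) \<rparr>"

end

theory Submission
  imports Defs "HOL-Library.Nat_Bijection" "HOL-Real_Asymp.Real_Asymp"
begin

text \<open>
  All odd objectives are equal to some \<open>f\<close> and all even ones to some \<open>g\<close>.  A set of more than
  \<open>\<lceil>p / 2\<rceil>\<close> indices contains both parities, so quasi-\<open>k\<close>-exact dominance forces exact dominance in \<open>f\<close>
  and in \<open>g\<close>, whatever \<open>\<epsilon>\<close> is.  If \<open>f + g\<close> is optimal at a solution, everything that dominates it has the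
  same value of \<open>f\<close>.  Binary weights give every subset of \<open>{0, \<dots>, n - 1}\<close> such a solution
  with its own value of \<open>f\<close>, hence approximation sets have at least \<open>2 ^ n\<close> elements.
\<close>

section \<open>Families without small approximation sets\<close>

text \<open>A dominating solution is at least as good in \<open>f\<close> and in \<open>g\<close>;
  where \<open>f + g\<close> is already optimal, neither inequality can be strict. The obstacle is
  therefore to make \<open>f + g\<close> optimal at all \<open>2 ^ n\<close> hard solutions
  simultaneously, with coefficients of only linearly many bits. Where the relevant solutions all
  have the same number of elements (full packings, assignments, tours), the two costs of each
  element add up to one constant. Paths differ in length, so there a potential difference takes the
  place of the constant. In cuts each inner vertex, and in spanning trees each leaf, contributes a
  fixed amount to \<open>f + g\<close> (in trees, at least that amount). Offsets such as
  \<open>n + 1\<close> and \<open>n + 2\<close> keep the smallest instances nondegenerate. None of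
  the families depends on p, k or \<epsilon>, so one family serves all k and \<epsilon> at
  once.\<close>

lemma large_subset_meets_parities:
  fixes p k :: nat
  assumes "\<lceil>real p / 2\<rceil> < int k" "S \<subseteq> {1..p}" "card S = k"
  obtains i j where "i \<in> S" "odd i" "j \<in> S" "even j"
proof -
  \<comment> \<open>\<open>Suc p div 2\<close> is the rounded-up half of \<open>p\<close>: the exact
    number of odd indices, and an upper bound for the number of even ones.\<close>
  have k: "Suc p div 2 < k"
    using assms(1) by linarith
  have "card {i \<in> {1..p}. odd i} \<le> Suc p div 2"
  proof -
    have "{i \<in> {1..p}. odd i} \<subseteq> (\<lambda>j. 2 * j + 1) ` {..<Suc p div 2}"
      by (auto elim!: oddE)
    from card_mono[OF _ this] show ?thesis
      using card_image_le[of "{..<Suc p div 2}" "\<lambda>j. 2 * j + 1"] by simp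
  qed
  moreover have "card {i \<in> {1..p}. even i} \<le> Suc p div 2"
  proof -
    have "{i \<in> {1..p}. even i} \<subseteq> (\<lambda>j. 2 * j) ` {1..p div 2}"
      by (auto elim!: evenE)
    from card_mono[OF _ this] show ?thesis
      using card_image_le[of "{1..p div 2}" "\<lambda>j. 2 * j"] by simp
  qed
  ultimately have "card {i \<in> {1..p}. odd i} < card S" "card {i \<in> {1..p}. even i} < card S"
    using k assms(3) by linarith+
  then have "\<not> S \<subseteq> {i \<in> {1..p}. odd i}" "\<not> S \<subseteq> {i \<in> {1..p}. even i}"
    by (auto dest!: card_mono[rotated])
  then show ?thesis
    using that assms(2) by blast
qed

text \<open>The base \<open>x + 1\<close> instead of \<open>x\<close> keeps every lower power below
  the top one even when \<open>x < 1\<close>.\<close>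

lemma poly_bounded_by_power:
  fixes q :: "real poly"
  obtains M where "\<And>x. x \<ge> 0 \<Longrightarrow> poly q x \<le> M * (x + 1) ^ degree q"
proof
  fix x :: real
  assume x: "x \<ge> 0"
  have "poly q x = (\<Sum>i\<le>degree q. coeff q i * x ^ i)"
    by (simp add: poly_altdef)
  also have "\<dots> \<le> (\<Sum>i\<le>degree q. \<bar>coeff q i\<bar> * (x + 1) ^ degree q)"
  proof (intro sum_mono mult_mono)
    fix i assume "i \<in> {..degree q}"
    then show "x ^ i \<le> (x + 1) ^ degree q"
      using x by (meson atMost_iff le_add_same_cancel1 le_add_same_cancel2 order_trans power_increasing power_mono zero_le_one)
  qed (use x in auto)
  finally show "poly q x \<le> (\<Sum>i\<le>degree q. \<bar>coeff q i\<bar>) * (x + 1) ^ degree q"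
    by (simp add: sum_distrib_right)
qed

lemma exponential_not_bounded_by_poly:
  fixes q :: "real poly" and s :: "nat \<Rightarrow> nat"
  assumes "\<And>n. s n \<le> c * (n + 1) ^ d"
  shows "\<exists>n. poly q (real (s n)) < 2 ^ n"
proof (rule ccontr)
  assume "\<nexists>n. poly q (real (s n)) < 2 ^ n"
  then have ge: "2 ^ n \<le> poly q (real (s n))" for n
    by (auto simp: not_less)
  obtain M where M: "\<And>x. x \<ge> 0 \<Longrightarrow> poly q x \<le> M * (x + 1) ^ degree q"
    using poly_bounded_by_power by blast
  define D where "D = d * degree q"
  \<comment> \<open>The sign of \<open>M\<close> is unknown, so the growth of the second factor can
    only be exploited through \<open>\<bar>M\<bar>\<close>. The summand 1 in
    \<open>real c + 1\<close> absorbs the one in \<open>real (s n) + 1\<close>.\<close>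
  define K where "K = \<bar>M\<bar> * (real c + 1) ^ degree q"
  have bound: "2 ^ n \<le> K * (real n + 1) ^ D" for n
  proof -
    have "real (s n) + 1 \<le> real c * (real n + 1) ^ d + 1"
      using of_nat_mono[OF assms[of n], where 'a = real] by (simp add: add_ac)
    also have "\<dots> \<le> (real c + 1) * (real n + 1) ^ d"
      by (simp add: distrib_right)
    finally have "(real (s n) + 1) ^ degree q \<le> ((real c + 1) * (real n + 1) ^ d) ^ degree q"
      by (intro power_mono) auto
    then have "(real (s n) + 1) ^ degree q \<le> (real c + 1) ^ degree q * (real n + 1) ^ D"
      by (simp add: power_mult_distrib power_mult D_def)
    then have "\<bar>M\<bar> * (real (s n) + 1) ^ degree q \<le> K * (real n + 1) ^ D"
      unfolding K_def mult.assoc by (intro mult_left_mono) auto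
    moreover have "M * (real (s n) + 1) ^ degree q \<le> \<bar>M\<bar> * (real (s n) + 1) ^ degree q"
      by (intro mult_right_mono) auto
    moreover have "2 ^ n \<le> M * (real (s n) + 1) ^ degree q"
      using ge[of n] M[of "real (s n)"] by (rule order_trans) simp
    ultimately show ?thesis
      by linarith
  qed
  have "(\<lambda>n. K * (real n + 1) ^ D / 2 ^ n) \<longlonglongrightarrow> 0"
    by real_asymp
  then have "\<forall>\<^sub>F n in sequentially. K * (real n + 1) ^ D / 2 ^ n < 1"
    by (rule order_tendstoD) simp
  then obtain n where "K * (real n + 1) ^ D / 2 ^ n < 1"
    by (auto simp: eventually_sequentially)
  with bound[of n] show False
    by (simp add: field_simps)
qed

text \<open>The interface to all six problems: an instance of size polynomial in \<open>n\<close>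
  whose hard solutions, one for each \<open>A\<close>, are told apart by the numbers
  \<open>h n A\<close>. The case distinction on the sense lets knapsack share the argument with the
  minimization problems.\<close>

lemma hard_family:
  fixes pb :: "('i, 'x) mo_problem" and f g :: "nat \<Rightarrow> 'x \<Rightarrow> rat" and h :: "nat \<Rightarrow> nat set \<Rightarrow> nat"
  assumes k: "\<lceil>real p / 2\<rceil> < int k"
    and size: "\<And>n. enc_size pb p (I n) \<le> c * (n + 1) ^ d"
    and parity: "\<And>n i. objective pb (I n) i = (if odd i then f n else g n)"
    and inj: "\<And>n. inj_on (h n) (Pow {..<n})"
    and hard: "\<And>n A. A \<subseteq> {..<n} \<Longrightarrow> \<exists>x\<in>feasible pb (I n). f n x = of_nat (h n A) \<and>
      (\<forall>y\<in>feasible pb (I n). case sense pb of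
          Minimize \<Rightarrow> f n x + g n x \<le> f n y + g n y
        | Maximize \<Rightarrow> f n y + g n y \<le> f n x + g n x)"
  shows "\<not> admits_poly_card_approx pb p k \<epsilon> I"
proof
  assume "admits_poly_card_approx pb p k \<epsilon> I"
  then obtain q :: "real poly" where q: "\<And>n. \<exists>P. quasi_exact_approx_set (sense pb) p k \<epsilon>
      (feasible pb (I n)) (objective pb (I n)) P \<and> finite P \<and>
      real (card P) \<le> poly q (real (enc_size pb p (I n)))"
    unfolding admits_poly_card_approx_def by blast
  obtain n where n: "poly q (real (enc_size pb p (I n))) < 2 ^ n"
    using exponential_not_bounded_by_poly[OF size] by blast
  obtain P where P: "quasi_exact_approx_set (sense pb) p k \<epsilon>
      (feasible pb (I n)) (objective pb (I n)) P" "finite P" "real (card P) < 2 ^ n"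
    using q[of n] n by fastforce
  have "of_nat (h n A) \<in> f n ` P" if A: "A \<in> Pow {..<n}" for A
  proof -
    obtain x where x: "x \<in> feasible pb (I n)" "f n x = of_nat (h n A)"
      and opt: "\<forall>y\<in>feasible pb (I n). case sense pb of
          Minimize \<Rightarrow> f n x + g n x \<le> f n y + g n y
        | Maximize \<Rightarrow> f n y + g n y \<le> f n x + g n x"
      using hard A by blast
    obtain y where y: "y \<in> P" "y \<in> feasible pb (I n)"
      "quasi_dominates (sense pb) p k \<epsilon> (objective pb (I n)) y x"
      using P(1) x(1) unfolding quasi_exact_approx_set_def by blast
    then obtain S where S: "S \<subseteq> {1..p}" "card S = k"
      "\<forall>i\<in>S. approx_better (sense pb) 1 (objective pb (I n) i y) (objective pb (I n) i x)"
      unfolding quasi_dominates_def by blast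
    from k S(1,2) obtain i j where "i \<in> S" "odd i" "j \<in> S" "even j"
      by (rule large_subset_meets_parities)
    with S(3) have "approx_better (sense pb) 1 (f n y) (f n x)"
      "approx_better (sense pb) 1 (g n y) (g n x)"
      by (force simp: parity)+
    \<comment> \<open>\<open>y\<close> is at least as good as \<open>x\<close> in both objectives
      and no better in their sum, so both values agree.\<close>
    with bspec[OF opt y(2)] have "f n y = f n x"
      by (cases "sense pb") (auto simp: of_rat_less_eq)
    then show ?thesis
      using y(1) x(2) by (metis imageI)
  qed
  then have "(\<lambda>A. of_nat (h n A)) ` Pow {..<n} \<subseteq> f n ` P"
    by blast
  from card_mono[OF _ this] have "card ((\<lambda>A. of_nat (h n A) :: rat) ` Pow {..<n}) \<le> card P"
    using P(2) card_image_le[OF P(2), of "f n"] by simp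
  moreover have "inj_on (\<lambda>A. of_nat (h n A) :: rat) (Pow {..<n})"
    using inj[of n] by (auto simp: inj_on_def)
  ultimately have "2 ^ n \<le> card P"
    by (simp add: card_image card_Pow)
  then have "real (2 ^ n) \<le> real (card P)"
    by (rule of_nat_mono)
  with P(3) show False
    by simp
qed

corollary hard_family_Minimize:
  fixes pb :: "('i, 'x) mo_problem" and f g :: "nat \<Rightarrow> 'x \<Rightarrow> rat" and h :: "nat \<Rightarrow> nat set \<Rightarrow> nat"
  assumes "sense pb = Minimize" "\<lceil>real p / 2\<rceil> < int k"
    and "\<And>n. enc_size pb p (I n) \<le> c * (n + 1) ^ d"
    and "\<And>n i. objective pb (I n) i = (if odd i then f n else g n)"
    and "\<And>n. inj_on (h n) (Pow {..<n})"
    and "\<And>n A. A \<subseteq> {..<n} \<Longrightarrow> \<exists>x\<in>feasible pb (I n). f n x = of_nat (h n A) \<and>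
      (\<forall>y\<in>feasible pb (I n). f n x + g n x \<le> f n y + g n y)"
  shows "\<not> admits_poly_card_approx pb p k \<epsilon> I"
  by (rule hard_family[OF assms(2-5)]) (simp add: assms(1,6))

text \<open>The binary number \<open>set_encode A\<close> identifies the subset; \<open>m\<close>
  stands for the part of the value that all hard solutions have in common.\<close>

lemma inj_on_set_encode_shift: "inj_on (\<lambda>A. m + set_encode A) (Pow {..<n})"
proof (rule inj_onI)
  fix A B
  assume "A \<in> Pow {..<n}" "B \<in> Pow {..<n}" "m + set_encode A = m + set_encode B"
  then show "A = B"
    using set_encode_eq[of A B] by (simp add: finite_subset[of _ "{..<n}"])
qed

lemma instance_familyI:
  assumes "\<And>n. I n \<in> instances pb p"
    and "\<And>n x i. x \<in> feasible pb (I n) \<Longrightarrow> objective pb (I n) i x > 0"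
    and "\<And>n. n \<le> enc_size pb p (I n)"
  shows "instance_family pb p I"
proof -
  have "filterlim (\<lambda>n. enc_size pb p (I n)) at_top sequentially"
    by (rule filterlim_at_top_mono[OF filterlim_ident]) (simp add: assms(3))
  then show ?thesis
    using assms(1,2) by (simp add: instance_family_def)
qed

section \<open>Bounding encoding sizes\<close>

text \<open>The additive 2 pays for the sign and for the denominator 1.\<close>

lemma rat_bits_of_nat_le:
  assumes "m < 2 ^ b"
  shows "rat_bits (of_nat m) \<le> b + 2"
proof -
  have "bitlen (int m) \<le> int b"
    using assms by (simp add: bitlen_le_iff_power)
  moreover have "bitlen 1 \<le> 1"
    by (simp add: bitlen_le_iff_power)
  ultimately show ?thesis
    using quotient_of_int[of "int m"] by (simp add: rat_bits_def)
qed

lemma coeff_bits_le: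
  assumes "\<And>i e. e \<in> E \<Longrightarrow> \<exists>m < 2 ^ b. c i e = of_nat m"
  shows "coeff_bits p E c \<le> p * (card E * (b + 2))"
  unfolding coeff_bits_def
proof -
  have "(\<Sum>e\<in>E. rat_bits (c i e)) \<le> card E * (b + 2)" for i
    using sum_bounded_above[of E "\<lambda>e. rat_bits (c i e)" "b + 2"] assms[of _ i] rat_bits_of_nat_le
    by fastforce
  then show "(\<Sum>i\<in>{1..p}. \<Sum>e\<in>E. rat_bits (c i e)) \<le> p * (card E * (b + 2))"
    using sum_bounded_above[of "{1..p}" "\<lambda>i. \<Sum>e\<in>E. rat_bits (c i e)" "card E * (b + 2)"]
    by simp
qed

text \<open>The common shape of all instances: at most quadratically many elements, with
  coefficients of linear bit length.\<close>

lemma coeff_bits_cubic: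
  assumes "\<And>i e. e \<in> E \<Longrightarrow> \<exists>m < 2 ^ (b * (n + 1)). c i e = of_nat m"
    and "card E \<le> a * (n + 1) ^ 2"
  shows "coeff_bits p E c \<le> p * a * (b + 2) * (n + 1) ^ 3"
proof -
  have "coeff_bits p E c \<le> p * (card E * (b * (n + 1) + 2))"
    using assms(1) by (rule coeff_bits_le)
  also have "\<dots> \<le> p * (a * (n + 1) ^ 2 * ((b + 2) * (n + 1)))"
    using assms(2) by (intro mult_mono) auto
  also have "\<dots> = p * a * (b + 2) * (n + 1) ^ 3"
    by (simp only: power2_eq_square power3_eq_cube mult_ac)
  finally show ?thesis .
qed

section \<open>Opposed costs on marked elements\<close>

text \<open>Summing over \<open>j\<close> avoids inverting \<open>m\<close>, and the base cost 1
  makes every element cost something, marked or not.\<close>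

definition mark_cost :: "nat \<Rightarrow> (nat \<Rightarrow> 'e) \<Rightarrow> 'e \<Rightarrow> nat" where
  "mark_cost n m e = 1 + (\<Sum>j<n. if e = m j then 2 ^ j else 0)"

text \<open>Since \<open>mark_cost\<close> lies between 1 and \<open>2 ^ n\<close>, so does its
  complement to \<open>2 ^ n + 1\<close>: the subtraction never truncates and both costs are
  positive.\<close>

definition opposed_cost :: "nat \<Rightarrow> (nat \<Rightarrow> 'e) \<Rightarrow> nat \<Rightarrow> 'e \<Rightarrow> rat" where
  "opposed_cost n m i e =
     of_nat (if odd i then mark_cost n m e else 2 ^ n + 1 - mark_cost n m e)"

lemma mark_cost_bounds: "0 < mark_cost n m e" "mark_cost n m e \<le> 2 ^ n"
proof -
  have "(\<Sum>j<n. if e = m j then 2 ^ j else 0) \<le> (\<Sum>j<n. 2 ^ j :: nat)"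
    by (intro sum_mono) auto
  also have "\<dots> < 2 ^ n"
    by (induction n) auto
  finally show "mark_cost n m e \<le> 2 ^ n"
    by (simp add: mark_cost_def)
qed (simp add: mark_cost_def)

lemma opposed_cost_pos: "0 < opposed_cost n m i e"
  using mark_cost_bounds[of n m e] by (simp add: opposed_cost_def)

text \<open>The instances use a number \<open>N\<close> of marks slightly above \<open>n\<close>.
  Costs are at most \<open>2 ^ N\<close>, hence fit into \<open>N + 1\<close> bits, and
  \<open>b\<close> absorbs the offset.\<close>

lemma coeff_bits_opposed_cost:
  fixes E :: "'e set"
  assumes "N + 1 \<le> b * (n + 1)" "card E \<le> a * (n + 1) ^ 2"
  shows "coeff_bits p E (opposed_cost N m) \<le> p * a * (b + 2) * (n + 1) ^ 3"
proof (rule coeff_bits_cubic[OF _ assms(2)])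
  fix i :: nat and e :: 'e
  define k where "k = (if odd i then mark_cost N m e else 2 ^ N + 1 - mark_cost N m e)"
  have "k < 2 ^ (N + 1)"
    using mark_cost_bounds[of N m e] by (auto simp: k_def less_diff_conv2 intro: le_less_trans)
  also have "(2::nat) ^ (N + 1) \<le> 2 ^ (b * (n + 1))"
    using assms(1) by (rule power_increasing) simp
  finally show "\<exists>k < 2 ^ (b * (n + 1)). opposed_cost N m i e = of_nat k"
    unfolding opposed_cost_def k_def by blast
qed

lemma sum_opposed_cost_parity:
  "sum (opposed_cost n m i) T =
     (if odd i then sum (opposed_cost n m 1) T else sum (opposed_cost n m 2) T)"
  by (simp add: opposed_cost_def)

lemma sum_opposed_cost_pos: "finite T \<Longrightarrow> T \<noteq> {} \<Longrightarrow> 0 < sum (opposed_cost n m i) T"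
  by (intro sum_pos opposed_cost_pos)

text \<open>Base costs count the elements of \<open>T\<close>; after exchanging the sums, index
  \<open>j\<close> contributes \<open>2 ^ j\<close> precisely when its mark lies in
  \<open>T\<close>.\<close>

lemma sum_opposed_cost_1:
  assumes "finite T"
  shows "sum (opposed_cost n m 1) T = of_nat (card T + set_encode {j. j < n \<and> m j \<in> T})"
proof -
  have "(\<Sum>e\<in>T. \<Sum>j<n. if e = m j then 2 ^ j else 0) = (\<Sum>j<n. \<Sum>e\<in>T. if e = m j then 2 ^ j else 0 :: nat)"
    by (rule sum.swap)
  also have "\<dots> = (\<Sum>j<n. if m j \<in> T then 2 ^ j else 0)"
    using assms by (intro sum.cong) (auto simp: sum.delta')
  also have "\<dots> = set_encode {j. j < n \<and> m j \<in> T}"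
    unfolding set_encode_def by (subst sum.inter_filter[symmetric]) (auto intro!: sum.cong)
  finally show ?thesis
    by (simp add: opposed_cost_def mark_cost_def sum.distrib flip: of_nat_sum)
qed

text \<open>The two costs cancel down to a constant per element, so solutions of equal cardinality
  tie, and under maximization the largest ones are optimal.\<close>

lemma sum_opposed_cost_total:
  "sum (opposed_cost n m 1) T + sum (opposed_cost n m 2) T = of_nat (card T * (2 ^ n + 1))"
proof -
  have "opposed_cost n m 1 e + opposed_cost n m 2 e = of_nat (2 ^ n + 1)" for e
    using mark_cost_bounds[of n m e]
    by (simp only: opposed_cost_def of_nat_add[symmetric]) (simp del: of_nat_add of_nat_Suc)
  then show ?thesis
    by (simp only: sum.distrib[symmetric]) (simp add: distrib_left)
qed

section \<open>Knapsack\<close>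

text \<open>Unit weights turn the capacity into a cardinality bound. The items from
  \<open>n + 1\<close> on are unmarked fillers; using \<open>n + 1\<close> instead of
  \<open>n\<close> leaves room for a nonempty packing also when \<open>n = 0\<close>.\<close>

definition hard_knapsack :: "nat \<Rightarrow> knapsack_instance" where
  "hard_knapsack n = \<lparr> kp_n = 2 * (n + 1), kp_weight = (\<lambda>_. 1), kp_capacity = of_nat (n + 1),
     kp_profit = opposed_cost (n + 1) id \<rparr>"

lemma feasible_hard_knapsack:
  "A \<in> feasible knapsack (hard_knapsack n) \<longleftrightarrow> A \<subseteq> {..<2 * (n + 1)} \<and> card A \<le> n + 1"
  by (simp add: knapsack_def hard_knapsack_def del: of_nat_Suc)

lemma objective_hard_knapsack:
  "objective knapsack (hard_knapsack n) i A = sum (opposed_cost (n + 1) id i) A"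
  by (simp add: knapsack_def hard_knapsack_def)

lemma hard_knapsack_size:
  "enc_size knapsack p (hard_knapsack n) \<le> (12 + p * 2 * (2 + 2)) * (n + 1) ^ 3"
proof -
  have one: "rat_bits 1 \<le> 3"
    using rat_bits_of_nat_le[of 1 1] by simp
  have "rat_bits (of_nat (n + 1)) \<le> n + 3"
    using rat_bits_of_nat_le[OF less_exp[of "n + 1"]] by (simp del: of_nat_Suc of_nat_add)
  then have "2 * (n + 1) + (\<Sum>j<2 * (n + 1). rat_bits 1) + rat_bits (of_nat (n + 1)) \<le> 12 * (n + 1)"
    using mult_left_mono[OF one, of "2 * (n + 1)"] by (simp del: of_nat_Suc of_nat_add)
  also have "\<dots> \<le> 12 * (n + 1) ^ 3"
    by (intro mult_left_mono self_le_power) auto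
  finally have "2 * (n + 1) + (\<Sum>j<2 * (n + 1). rat_bits 1) + rat_bits (of_nat (n + 1))
    \<le> 12 * (n + 1) ^ 3" .
  moreover have "coeff_bits p {..<2 * (n + 1)} (opposed_cost (n + 1) id) \<le> p * 2 * (2 + 2) * (n + 1) ^ 3"
    by (rule coeff_bits_opposed_cost) (simp_all add: power2_eq_square)
  ultimately show ?thesis
    by (simp add: knapsack_def hard_knapsack_def distrib_right del: of_nat_Suc of_nat_add)
qed

text \<open>The feasible set is only enclosed between the nonempty packings and all packings, which
  treats both versions at once: the witnesses are full packings, hence nonempty, and the bound on
  the total holds for every packing.\<close>

lemma hard_knapsack_not_approx:
  assumes "\<lceil>real p / 2\<rceil> < int k"
    and "sense pb = Maximize" "objective pb = objective knapsack" "enc_size pb = enc_size knapsack"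
    and sub: "\<And>n. feasible pb (hard_knapsack n) \<subseteq> feasible knapsack (hard_knapsack n)"
    and sup: "\<And>n. feasible knapsack (hard_knapsack n) - {{}} \<subseteq> feasible pb (hard_knapsack n)"
  shows "\<not> admits_poly_card_approx pb p k \<epsilon> hard_knapsack"
proof (rule hard_family[OF assms(1)])
  show "enc_size pb p (hard_knapsack n) \<le> (12 + p * 2 * (2 + 2)) * (n + 1) ^ 3" for n
    using hard_knapsack_size assms(4) by simp
  show "objective pb (hard_knapsack n) i =
      (if odd i then sum (opposed_cost (n + 1) id 1) else sum (opposed_cost (n + 1) id 2))" for n i
    by (rule ext) (auto simp only: assms(3) objective_hard_knapsack sum_opposed_cost_parity[of _ _ i]
        split: if_splits)
  show "inj_on (\<lambda>A. n + 1 + set_encode A) (Pow {..<n})" for n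
    by (rule inj_on_set_encode_shift)
next
  fix n :: nat and A
  assume A: "A \<subseteq> {..<n}"
  \<comment> \<open>One filler \<open>n + 1 + j\<close> for each missing \<open>j\<close> completes
    the packing to exactly \<open>n + 1\<close> items without touching a mark.\<close>
  define B where "B = A \<union> (\<lambda>j. n + 1 + j) ` ({..n} - A)"
  have "finite A" "A \<subseteq> {..n}"
    using A by (auto intro: finite_subset)
  then have "card ({..n} - A) = n + 1 - card A" "card A \<le> n + 1"
    using card_mono[OF finite_atMost, of A n] by (simp_all add: card_Diff_subset)
  moreover have "card ((\<lambda>j. n + 1 + j) ` ({..n} - A)) = card ({..n} - A)"
    by (rule card_image) (simp add: inj_on_def)
  moreover have "card B = card A + card ((\<lambda>j. n + 1 + j) ` ({..n} - A))"
    unfolding B_def using A \<open>finite A\<close> by (intro card_Un_disjoint) auto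
  ultimately have card: "card B = n + 1"
    by simp
  have marks: "{j. j < n + 1 \<and> id j \<in> B} = A"
    using A by (auto simp: B_def)
  have "finite B"
    using card by (intro card_ge_0_finite) simp
  then have val: "sum (opposed_cost (n + 1) id 1) B = of_nat (n + 1 + set_encode A)"
    by (simp only: sum_opposed_cost_1 card marks)
  have "B \<in> feasible knapsack (hard_knapsack n)" "B \<noteq> {}"
    using A card by (auto simp: feasible_hard_knapsack B_def)
  then have B: "B \<in> feasible pb (hard_knapsack n)"
    using sup by blast
  have "sum (opposed_cost (n + 1) id 1) y + sum (opposed_cost (n + 1) id 2) y
      \<le> sum (opposed_cost (n + 1) id 1) B + sum (opposed_cost (n + 1) id 2) B"
    if "y \<in> feasible pb (hard_knapsack n)" for y
    unfolding sum_opposed_cost_total of_nat_le_iff card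
    using subsetD[OF sub that] by (intro mult_right_mono) (auto simp: feasible_hard_knapsack)
  then show "\<exists>x\<in>feasible pb (hard_knapsack n).
      sum (opposed_cost (n + 1) id 1) x = of_nat (n + 1 + set_encode A) \<and>
      (\<forall>y\<in>feasible pb (hard_knapsack n). case sense pb of
          Minimize \<Rightarrow> sum (opposed_cost (n + 1) id 1) x + sum (opposed_cost (n + 1) id 2) x
            \<le> sum (opposed_cost (n + 1) id 1) y + sum (opposed_cost (n + 1) id 2) y
        | Maximize \<Rightarrow> sum (opposed_cost (n + 1) id 1) y + sum (opposed_cost (n + 1) id 2) y
            \<le> sum (opposed_cost (n + 1) id 1) x + sum (opposed_cost (n + 1) id 2) x)"
    using B val assms(2) by (intro bexI[of _ B]) auto
qed

lemma hard_knapsack_family: "instance_family nonempty_knapsack p hard_knapsack"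
proof (rule instance_familyI)
  show "hard_knapsack n \<in> instances nonempty_knapsack p" for n
    by (simp add: nonempty_knapsack_def knapsack_def hard_knapsack_def nonneg_coeffs_def
        opposed_cost_pos less_imp_le)
  show "n \<le> enc_size nonempty_knapsack p (hard_knapsack n)" for n
    by (simp add: nonempty_knapsack_def knapsack_def hard_knapsack_def)
  show "0 < objective nonempty_knapsack (hard_knapsack n) i x"
    if "x \<in> feasible nonempty_knapsack (hard_knapsack n)" for n x i
    using that finite_subset[of x "{..<2 * (n + 1)}"]
    by (auto simp: nonempty_knapsack_def feasible_hard_knapsack objective_hard_knapsack
        intro!: sum_opposed_cost_pos)
qed

section \<open>Assignment\<close>

text \<open>For \<open>A\<close> inside \<open>{..<N}\<close> this is the product of the
  transpositions of \<open>i\<close> and \<open>N + i\<close> over \<open>i \<in> A\<close>. The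
  guard \<open>N \<le> i\<close> stops truncated subtraction from sending small \<open>i\<close> to
  0 when \<open>0 \<in> A\<close>.\<close>

definition pair_swap :: "nat \<Rightarrow> nat set \<Rightarrow> nat \<Rightarrow> nat" where
  "pair_swap N A i = (if i \<in> A then N + i else if N \<le> i \<and> i - N \<in> A then i - N else i)"

lemma pair_swap_permutes:
  assumes "A \<subseteq> {..<N}"
  shows "pair_swap N A permutes {..<2 * N}"
proof -
  have "pair_swap N A (pair_swap N A i) = i" for i
    using assms by (auto simp: pair_swap_def)
  moreover have "pair_swap N A i = i" if "i \<notin> {..<2 * N}" for i
    using assms that by (auto simp: pair_swap_def)
  ultimately show ?thesis
    unfolding permutes_def by metis
qed

text \<open>The marked entries are those that \<open>pair_swap\<close> selects exactly for
  \<open>j \<in> A\<close>. Every permutation selects \<open>2 * (n + 1)\<close> entries, so all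
  assignments tie in the total.\<close>

definition hard_assignment :: "nat \<Rightarrow> assignment_instance" where
  "hard_assignment n = \<lparr> asg_n = 2 * (n + 1),
     asg_cost = opposed_cost (n + 1) (\<lambda>j. (j, n + 1 + j)) \<rparr>"

text \<open>Recasts a permutation as the set of matrix entries it selects, to which the facts on
  sums of \<open>opposed_cost\<close> apply.\<close>

definition perm_graph :: "nat \<Rightarrow> (nat \<Rightarrow> nat) \<Rightarrow> (nat \<times> nat) set" where
  "perm_graph N \<pi> = (\<lambda>j. (j, \<pi> j)) ` {..<N}"

lemma finite_perm_graph: "finite (perm_graph N \<pi>)"
  by (simp add: perm_graph_def)

lemma card_perm_graph: "card (perm_graph N \<pi>) = N"
  unfolding perm_graph_def by (subst card_image) (auto simp: inj_on_def)

lemma feasible_hard_assignment: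
  "\<pi> \<in> feasible assignment (hard_assignment n) \<longleftrightarrow> \<pi> permutes {..<2 * (n + 1)}"
  by (simp add: assignment_def hard_assignment_def)

lemma objective_hard_assignment:
  "objective assignment (hard_assignment n) i \<pi> =
     sum (opposed_cost (n + 1) (\<lambda>j. (j, n + 1 + j)) i) (perm_graph (2 * (n + 1)) \<pi>)"
  unfolding perm_graph_def
  by (subst sum.reindex) (auto simp: inj_on_def assignment_def hard_assignment_def)

lemma hard_assignment_size:
  "enc_size assignment p (hard_assignment n) \<le> (2 + p * 4 * (2 + 2)) * (n + 1) ^ 3"
proof -
  have "2 * (n + 1) \<le> 2 * (n + 1) ^ 3"
    by (intro mult_left_mono self_le_power) auto
  moreover have "coeff_bits p ({..<2 * (n + 1)} \<times> {..<2 * (n + 1)})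
      (opposed_cost (n + 1) (\<lambda>j. (j, n + 1 + j))) \<le> p * 4 * (2 + 2) * (n + 1) ^ 3"
    by (rule coeff_bits_opposed_cost) (simp_all add: power2_eq_square)
  ultimately show ?thesis
    by (simp add: assignment_def hard_assignment_def distrib_right)
qed

lemma hard_assignment_not_approx:
  assumes "\<lceil>real p / 2\<rceil> < int k"
  shows "\<not> admits_poly_card_approx assignment p k \<epsilon> hard_assignment"
proof -
  let ?f = "\<lambda>n i \<pi>. sum (opposed_cost (n + 1) (\<lambda>j. (j, n + 1 + j)) i) (perm_graph (2 * (n + 1)) \<pi>)"
  show ?thesis
  proof (rule hard_family_Minimize[OF _ assms hard_assignment_size])
    show "sense assignment = Minimize"
      by (simp add: assignment_def)
    show "objective assignment (hard_assignment n) i = (if odd i then ?f n 1 else ?f n 2)" for n i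
      by (rule ext) (auto simp only: objective_hard_assignment sum_opposed_cost_parity[of _ _ i] split: if_splits)
    show "inj_on (\<lambda>A. 2 * (n + 1) + set_encode A) (Pow {..<n})" for n
      by (rule inj_on_set_encode_shift)
  next
    fix n :: nat and A
    assume A: "A \<subseteq> {..<n}"
    then have "A \<subseteq> {..<n + 1}"
      by auto
    then have feas: "pair_swap (n + 1) A \<in> feasible assignment (hard_assignment n)"
      unfolding feasible_hard_assignment by (rule pair_swap_permutes)
    have "{j. j < n + 1 \<and> (j, n + 1 + j) \<in> perm_graph (2 * (n + 1)) (pair_swap (n + 1) A)} = A"
      using A by (auto simp: perm_graph_def pair_swap_def image_iff split: if_splits)
    then have val: "?f n 1 (pair_swap (n + 1) A) = of_nat (2 * (n + 1) + set_encode A)"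
      by (subst sum_opposed_cost_1) (simp_all only: card_perm_graph finite_perm_graph)
    show "\<exists>x\<in>feasible assignment (hard_assignment n). ?f n 1 x = of_nat (2 * (n + 1) + set_encode A) \<and>
      (\<forall>y\<in>feasible assignment (hard_assignment n). ?f n 1 x + ?f n 2 x \<le> ?f n 1 y + ?f n 2 y)"
      unfolding sum_opposed_cost_total card_perm_graph
      by (intro bexI[OF _ feas] conjI ballI val order_refl)
  qed
qed

lemma hard_assignment_family: "instance_family assignment p hard_assignment"
proof (rule instance_familyI)
  show "hard_assignment n \<in> instances assignment p" for n
    by (simp add: assignment_def hard_assignment_def nonneg_coeffs_def opposed_cost_pos less_imp_le)
  show "n \<le> enc_size assignment p (hard_assignment n)" for n
    by (simp add: assignment_def hard_assignment_def)
  show "0 < objective assignment (hard_assignment n) i \<pi>" for n i \<pi>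
    unfolding objective_hard_assignment
    by (rule sum_opposed_cost_pos) (auto simp: perm_graph_def lessThan_Suc)
qed

section \<open>Shortest path\<close>

text \<open>As all pairs are joined upwards, paths from 0 to \<open>N\<close> correspond to
  arbitrary sets of intermediate vertices.\<close>

definition dag :: "nat \<Rightarrow> nat pair_pre_digraph" where
  "dag N = \<lparr> pverts = {..N}, parcs = {(u, v). u < v \<and> v \<le> N} \<rparr>"

text \<open>
  The two costs of an arc \<open>(u, v)\<close> add up to a multiple of \<open>v - u\<close>, so the sum of the two objectives
  telescopes along every path, whatever its number of arcs.
\<close>

definition hard_path_network :: "nat \<Rightarrow> network" where
  "hard_path_network n = \<lparr> net_graph = dag (n + 1), net_source = 0, net_target = n + 1,
     net_coeff = (\<lambda>i (u, v). of_nat (if odd i then 2 ^ u else 2 ^ (n + 1) * (v - u) - 2 ^ u)) \<rparr>"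

lemma pair_digraph_dag: "pair_digraph (dag N)"
proof
  show "finite (parcs (dag N))"
    by (rule finite_subset[of _ "{..N} \<times> {..N}"]) (auto simp: dag_def)
qed (auto simp: dag_def)

lemma card_arcs_dag: "card (parcs (dag N)) \<le> (N + 1) ^ 2"
proof -
  have "parcs (dag N) \<subseteq> {..N} \<times> {..N}"
    by (auto simp: dag_def)
  then have "card (parcs (dag N)) \<le> card ({..N} \<times> {..N})"
    by (intro card_mono) auto
  then show ?thesis
    by (simp add: power2_eq_square card_cartesian_product)
qed

lemma feasible_hard_path:
  "P \<in> feasible shortest_path (hard_path_network n) \<longleftrightarrow>
     set P \<subseteq> {(u, v). u < v \<and> v \<le> n + 1} \<and> pcas 0 P (n + 1) \<and> distinct (pawalk_verts 0 P)"
  by (simp add: shortest_path_def hard_path_network_def pre_digraph.apath_def pre_digraph.awalk_def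
      cas_with_proj_eq awalk_verts_with_proj_eq dag_def)

text \<open>Ensures that the subtraction in the even costs does not truncate and leaves a positive
  number.\<close>

lemma hard_path_coeff_pos:
  assumes "u < v" "v \<le> n + 1"
  shows "2 ^ u < (2::nat) ^ (n + 1) * (v - u)"
proof -
  have "(2::nat) ^ u < 2 ^ (n + 1) * 1"
    using assms by (simp add: power_strict_increasing_iff del: power_Suc)
  also have "\<dots> \<le> 2 ^ (n + 1) * (v - u)"
    using assms by (intro mult_left_mono) auto
  finally show ?thesis .
qed

lemma hard_path_coeff_total:
  assumes "u < v" "v \<le> n + 1"
  shows "net_coeff (hard_path_network n) 1 (u, v) + net_coeff (hard_path_network n) 2 (u, v)
    = of_nat (2 ^ (n + 1) * (v - u))"
  using hard_path_coeff_pos[OF assms]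
  by (simp add: hard_path_network_def flip: of_nat_add)

text \<open>The conjunct \<open>a \<le> b\<close> is carried through the induction because
  \<open>(v - a) + (b - v) = b - a\<close> on naturals needs
  \<open>a \<le> v \<le> b\<close>.\<close>

lemma hard_path_total:
  assumes "set P \<subseteq> {(u, v). u < v \<and> v \<le> n + 1}" "pcas a P b"
  shows "a \<le> b \<and> (\<Sum>e\<leftarrow>P. net_coeff (hard_path_network n) 1 e)
    + (\<Sum>e\<leftarrow>P. net_coeff (hard_path_network n) 2 e) = of_nat (2 ^ (n + 1) * (b - a))"
  using assms
proof (induction P arbitrary: a)
  case (Cons e P)
  obtain v where e: "e = (a, v)" "a < v" "v \<le> n + 1" "pcas v P b"
    using Cons.prems by (cases e) auto
  have IH: "v \<le> b" "(\<Sum>e\<leftarrow>P. net_coeff (hard_path_network n) 1 e)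
    + (\<Sum>e\<leftarrow>P. net_coeff (hard_path_network n) 2 e) = of_nat (2 ^ (n + 1) * (b - v))"
    using Cons.IH[OF _ e(4)] Cons.prems by auto
  have "(\<Sum>e\<leftarrow>e # P. net_coeff (hard_path_network n) 1 e) + (\<Sum>e\<leftarrow>e # P. net_coeff (hard_path_network n) 2 e)
    = of_nat (2 ^ (n + 1) * (v - a)) + of_nat (2 ^ (n + 1) * (b - v))"
    unfolding IH(2)[symmetric] hard_path_coeff_total[OF e(2,3), symmetric] e(1) by simp
  also have "\<dots> = of_nat (2 ^ (n + 1) * (v - a + (b - v)))"
    by (simp only: distrib_left of_nat_add)
  finally show ?case
    using IH(1) e(2) by simp
qed simp

text \<open>An arc costs \<open>2 ^ u\<close> at its tail \<open>u\<close> in the odd objectives, so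
  a path encodes all its vertices but the target. The induction adds a new smallest vertex in front;
  the lower bound on the visited vertices keeps the longer path simple.\<close>

lemma hard_path_through:
  assumes "finite A" "u \<le> n" "\<And>a. a \<in> A \<Longrightarrow> u < a \<and> a \<le> n"
  shows "\<exists>P. set P \<subseteq> {(u, v). u < v \<and> v \<le> n + 1} \<and> pcas u P (n + 1)
    \<and> distinct (pawalk_verts u P) \<and> (\<forall>v\<in>set (pawalk_verts u P). u \<le> v)
    \<and> (\<Sum>e\<leftarrow>P. net_coeff (hard_path_network n) 1 e) = of_nat (set_encode (insert u A))"
  using assms
proof (induction A arbitrary: u rule: finite_linorder_min_induct)
  case empty
  then show ?case
    by (intro exI[of _ "[(u, n + 1)]"]) (auto simp: hard_path_network_def)
next
  case (insert b A)
  obtain P where P: "set P \<subseteq> {(u, v). u < v \<and> v \<le> n + 1}" "pcas b P (n + 1)"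
    "distinct (pawalk_verts b P)" "\<forall>v\<in>set (pawalk_verts b P). b \<le> v"
    "(\<Sum>e\<leftarrow>P. net_coeff (hard_path_network n) 1 e) = of_nat (set_encode (insert b A))"
    using insert.IH[of b] insert.prems insert.hyps by auto
  have b: "u < b" "b \<le> n"
    using insert.prems by auto
  have "u \<notin> insert b A"
    using insert.prems by blast
  then have "set_encode (insert u (insert b A)) = 2 ^ u + set_encode (insert b A)"
    using insert.hyps by (intro set_encode_insert) auto
  then show ?case
    using P b by (intro exI[of _ "(u, b) # P"]) (fastforce simp: hard_path_network_def)
qed

lemma hard_path_size:
  "enc_size shortest_path p (hard_path_network n) \<le> (6 + p * 4 * (2 + 2)) * (n + 1) ^ 3"
proof -
  have arcs: "card (parcs (dag (n + 1))) \<le> 4 * (n + 1) ^ 2"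
    using card_arcs_dag[of "n + 1"] by (simp add: power2_eq_square)
  also have "\<dots> \<le> 4 * (n + 1) ^ 3"
    by (intro mult_left_mono power_increasing) auto
  finally have "card (parcs (dag (n + 1))) \<le> 4 * (n + 1) ^ 3" .
  moreover have "n + 2 \<le> 2 * (n + 1) ^ 3"
    using self_le_power[of "n + 1" 3] by simp
  moreover have "coeff_bits p (parcs (dag (n + 1))) (net_coeff (hard_path_network n))
    \<le> p * 4 * (2 + 2) * (n + 1) ^ 3"
  proof (rule coeff_bits_cubic)
    fix i :: nat and e
    assume "e \<in> parcs (dag (n + 1))"
    then obtain u v where e: "e = (u, v)" "u < v" "v \<le> n + 1"
      by (auto simp: dag_def)
    have "2 ^ (n + 1) * (v - u) < (2::nat) ^ (n + 1) * 2 ^ (n + 1)"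
    proof (rule mult_strict_left_mono)
      have "v - u < 2 ^ (v - u)" by (rule less_exp)
      also have "\<dots> \<le> (2::nat) ^ (n + 1)"
        using e by (intro power_increasing) auto
      finally show "v - u < 2 ^ (n + 1)" .
    qed simp
    then have le: "2 ^ (n + 1) * (v - u) < (2::nat) ^ (2 * (n + 1))"
      by (simp only: mult_2 power_add)
    then have "2 ^ u < (2::nat) ^ (2 * (n + 1))"
      by (rule less_trans[OF hard_path_coeff_pos[OF e(2,3)]])
    with le have "(if odd i then 2 ^ u else 2 ^ (n + 1) * (v - u) - 2 ^ u) < (2::nat) ^ (2 * (n + 1))"
      by (cases "even i") (simp_all only: if_True if_False simp_thms less_imp_diff_less)
    then show "\<exists>m < 2 ^ (2 * (n + 1)). net_coeff (hard_path_network n) i e = of_nat m"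
      unfolding hard_path_network_def e(1) network.simps prod.case by blast
  qed (rule arcs)
  ultimately show ?thesis
    by (simp add: shortest_path_def network_size_def hard_path_network_def distrib_right dag_def)
qed

lemma hard_path_not_approx:
  assumes "\<lceil>real p / 2\<rceil> < int k"
  shows "\<not> admits_poly_card_approx shortest_path p k \<epsilon> hard_path_network"
proof -
  let ?f = "\<lambda>n i P. \<Sum>e\<leftarrow>P. net_coeff (hard_path_network n) i e"
  show ?thesis
  proof (rule hard_family_Minimize[OF _ assms hard_path_size])
    show "sense shortest_path = Minimize"
      by (simp add: shortest_path_def)
    show "objective shortest_path (hard_path_network n) i = (if odd i then ?f n 1 else ?f n 2)" for n i
    proof -
      have "net_coeff (hard_path_network n) i = net_coeff (hard_path_network n) (if odd i then 1 else 2)"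
        by (auto simp: hard_path_network_def fun_eq_iff)
      then show ?thesis
        by (cases "odd i") (simp_all add: shortest_path_def)
    qed
    \<comment> \<open>Every path leaves the source 0, so \<open>A\<close> is shifted to the
      intermediate vertices \<open>1, ..., n\<close>.\<close>
    show "inj_on (\<lambda>A. set_encode (insert 0 (Suc ` A))) (Pow {..<n})" for n
    proof (rule inj_onI)
      fix A B
      assume "A \<in> Pow {..<n}" "B \<in> Pow {..<n}"
        "set_encode (insert 0 (Suc ` A)) = set_encode (insert 0 (Suc ` B))"
      then have "insert 0 (Suc ` A) = insert 0 (Suc ` B)"
        by (subst (asm) set_encode_eq) (auto intro: finite_subset)
      then have "Suc ` A = Suc ` B"
        by blast
      then show "A = B"
        by (simp add: inj_image_eq_iff)
    qed
  next
    fix n :: nat and A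
    assume A: "A \<subseteq> {..<n}"
    then have "finite (Suc ` A)"
      by (simp add: finite_subset)
    from hard_path_through[OF this, of 0 n] A obtain P where
      P: "P \<in> feasible shortest_path (hard_path_network n)"
        "?f n 1 P = of_nat (set_encode (insert 0 (Suc ` A)))"
      unfolding feasible_hard_path by fastforce
    have "?f n 1 y + ?f n 2 y = of_nat (2 ^ (n + 1) * (n + 1))"
      if "y \<in> feasible shortest_path (hard_path_network n)" for y
      using that hard_path_total[of y n 0 "n + 1"] unfolding feasible_hard_path by simp
    then show "\<exists>x\<in>feasible shortest_path (hard_path_network n).
        ?f n 1 x = of_nat (set_encode (insert 0 (Suc ` A))) \<and>
        (\<forall>y\<in>feasible shortest_path (hard_path_network n). ?f n 1 x + ?f n 2 x \<le> ?f n 1 y + ?f n 2 y)"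
      by (intro bexI[OF _ P(1)] conjI ballI P(2)) (simp only: P(1) order_refl)
  qed
qed

lemma hard_path_arc_pos:
  assumes "u < v" "v \<le> n + 1"
  shows "0 < net_coeff (hard_path_network n) i (u, v)"
  using hard_path_coeff_pos[OF assms] by (simp add: hard_path_network_def)

lemma hard_path_family: "instance_family shortest_path p hard_path_network"
proof (rule instance_familyI)
  have "net_coeff (hard_path_network n) i e \<ge> 0" for n i e
    by (cases e) (simp add: hard_path_network_def)
  then show "hard_path_network n \<in> instances shortest_path p" for n
    using pair_digraph_dag
    by (simp add: shortest_path_def networks_def nonneg_coeffs_def)
      (simp add: hard_path_network_def dag_def)
  show "n \<le> enc_size shortest_path p (hard_path_network n)" for n
    by (simp add: shortest_path_def network_size_def hard_path_network_def dag_def)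
  show "0 < objective shortest_path (hard_path_network n) i P"
    if "P \<in> feasible shortest_path (hard_path_network n)" for n i P
  proof -
    have P: "set P \<subseteq> {(u, v). u < v \<and> v \<le> n + 1}" "P \<noteq> []"
      using that by (auto simp: feasible_hard_path)
    then have pos: "0 < net_coeff (hard_path_network n) i e" if "e \<in> set P" for e
      using that hard_path_arc_pos by auto
    obtain e Q where "P = e # Q"
      using P(2) by (cases P) auto
    moreover have "0 \<le> (\<Sum>e\<leftarrow>Q. net_coeff (hard_path_network n) i e)"
      using pos \<open>P = e # Q\<close> by (intro sum_list_nonneg) (auto intro: less_imp_le)
    ultimately show ?thesis
      using pos[of e] by (simp add: shortest_path_def)
  qed
qed

section \<open>Minimum s-t-cut\<close>

text \<open>Each inner vertex \<open>j < N\<close> lies on one path from source \<open>N\<close> to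
  target \<open>N + 1\<close>, so a cut separates exactly one of its two arcs.\<close>

definition fan :: "nat \<Rightarrow> nat pair_pre_digraph" where
  "fan N = \<lparr> pverts = {..N + 1},
     parcs = insert (N, N + 1) ({N} \<times> {..<N} \<union> {..<N} \<times> {N + 1}) \<rparr>"

text \<open>\<open>min u v\<close> is the inner vertex of either arc. Odd objectives charge it on
  the source side, even ones on the target side. The direct arc belongs to every cut and keeps the
  values positive.\<close>

definition hard_cut_network :: "nat \<Rightarrow> network" where
  "hard_cut_network n = \<lparr> net_graph = fan n, net_source = n, net_target = n + 1,
     net_coeff = (\<lambda>i (u, v). if (u, v) = (n, n + 1) then 1
       else if (u = n) = even i then 2 ^ min u v else 0) \<rparr>"

lemma feasible_hard_cut:
  "S \<in> feasible min_st_cut (hard_cut_network n) \<longleftrightarrow> S \<subseteq> {..n + 1} \<and> n \<in> S \<and> n + 1 \<notin> S"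
  by (simp add: min_st_cut_def hard_cut_network_def fan_def)

lemma objective_hard_cut:
  assumes "S \<in> feasible min_st_cut (hard_cut_network n)"
  shows "objective min_st_cut (hard_cut_network n) i S
    = of_nat (1 + (\<Sum>j<n. if (j \<in> S) = odd i then 2 ^ j else 0))"
proof -
  define c where "c = net_coeff (hard_cut_network n) i"
  \<comment> \<open>The unique cut arc at the inner vertex \<open>j\<close>.\<close>
  define arc where "arc j = (if j \<in> S then (j, n + 1) else (n, j))" for j
  have "{e \<in> parcs (fan n). fst e \<in> S \<and> snd e \<notin> S} = insert (n, n + 1) (arc ` {..<n})"
    using assms unfolding feasible_hard_cut by (auto simp: fan_def arc_def)
  then have "objective min_st_cut (hard_cut_network n) i S = sum c (insert (n, n + 1) (arc ` {..<n}))"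
    by (simp add: min_st_cut_def hard_cut_network_def c_def)
  also have "\<dots> = c (n, n + 1) + sum c (arc ` {..<n})"
    by (subst sum.insert) (auto simp: arc_def)
  also have "sum c (arc ` {..<n}) = (\<Sum>j<n. c (arc j))"
    by (subst sum.reindex) (auto simp: inj_on_def arc_def split: if_splits)
  also have "\<dots> = (\<Sum>j<n. of_nat (if (j \<in> S) = odd i then 2 ^ j else 0))"
    by (intro sum.cong) (auto simp: c_def arc_def hard_cut_network_def)
  also have "c (n, n + 1) = 1"
    by (simp add: c_def hard_cut_network_def)
  finally show ?thesis
    by (simp only: of_nat_add of_nat_sum of_nat_1)
qed

lemma hard_cut_size:
  "enc_size min_st_cut p (hard_cut_network n) \<le> (5 + p * 3 * (1 + 2)) * (n + 1) ^ 3"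
proof -
  have "card (parcs (fan n)) \<le> Suc (card ({n} \<times> {..<n} \<union> {..<n} \<times> {n + 1}))"
    unfolding fan_def by (simp add: card_insert_if)
  also have "card ({n} \<times> {..<n} \<union> {..<n} \<times> {n + 1}) \<le> n + n"
    by (rule order_trans[OF card_Un_le]) (simp add: card_cartesian_product)
  finally have arcs: "card (parcs (fan n)) \<le> 3 * (n + 1)"
    by simp
  have "n + 1 \<le> (n + 1) ^ 3" "n + 1 \<le> (n + 1) ^ 2"
    by (rule self_le_power; simp)+
  \<comment> \<open>General in \<open>m\<close>, to be used with both powers of
    \<open>n + 1\<close>.\<close>
  moreover have "n + 2 + a \<le> 5 * m" "a \<le> 3 * m" if "a \<le> 3 * (n + 1)" "n + 1 \<le> m" for a m :: nat
    using that by simp_all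
  ultimately have le: "n + 2 + card (parcs (fan n)) \<le> 5 * (n + 1) ^ 3"
    and "card (parcs (fan n)) \<le> 3 * (n + 1) ^ 2"
    using arcs by blast+
  have "coeff_bits p (parcs (fan n)) (net_coeff (hard_cut_network n)) \<le> p * 3 * (1 + 2) * (n + 1) ^ 3"
  proof (rule coeff_bits_cubic[OF _ \<open>card (parcs (fan n)) \<le> 3 * (n + 1) ^ 2\<close>])
    fix i :: nat and e
    assume "e \<in> parcs (fan n)"
    then obtain u v where e: "e = (u, v)" "min u v \<le> n"
      by (auto simp: fan_def)
    define m :: nat where "m = (if (u, v) = (n, n + 1) then 1 else if (u = n) = even i then 2 ^ min u v else 0)"
    have "m \<le> 2 ^ min u v"
      by (simp add: m_def)
    also have "(2::nat) ^ min u v < 2 ^ (1 * (n + 1))"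
      using e(2) by (intro power_strict_increasing) auto
    finally have "m < 2 ^ (1 * (n + 1))" .
    moreover have "net_coeff (hard_cut_network n) i e = of_nat m"
      by (auto simp: hard_cut_network_def m_def e(1))
    ultimately show "\<exists>m < 2 ^ (1 * (n + 1)). net_coeff (hard_cut_network n) i e = of_nat m"
      by blast
  qed
  with le show ?thesis
    by (simp add: min_st_cut_def network_size_def hard_cut_network_def distrib_right fan_def)
qed

lemma hard_cut_not_approx:
  assumes "\<lceil>real p / 2\<rceil> < int k"
  shows "\<not> admits_poly_card_approx min_st_cut p k \<epsilon> hard_cut_network"
proof (rule hard_family_Minimize[OF _ assms hard_cut_size])
  show "sense min_st_cut = Minimize"
    by (simp add: min_st_cut_def)
  let ?f = "\<lambda>n i. objective min_st_cut (hard_cut_network n) i"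
  show "?f n i = (if odd i then ?f n 1 else ?f n 2)" for n i
  proof -
    have "net_coeff (hard_cut_network n) i = net_coeff (hard_cut_network n) (if odd i then 1 else 2)"
      by (auto simp: hard_cut_network_def fun_eq_iff)
    then show ?thesis
      by (cases "odd i") (simp_all add: min_st_cut_def)
  qed
  show "inj_on (\<lambda>A. 1 + set_encode A) (Pow {..<n})" for n
    by (rule inj_on_set_encode_shift)
  fix n :: nat and A
  assume A: "A \<subseteq> {..<n}"
  then have feas: "insert n A \<in> feasible min_st_cut (hard_cut_network n)"
    by (auto simp: feasible_hard_cut)
  have "(\<Sum>j<n. if j \<in> insert n A then 2 ^ j else 0) = set_encode A"
    unfolding set_encode_def using A
    by (subst sum.inter_restrict[symmetric]) (auto intro!: sum.cong)
  then have val: "?f n 1 (insert n A) = of_nat (1 + set_encode A)"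
    by (simp only: objective_hard_cut[OF feas] odd_one simp_thms)
  \<comment> \<open>Each inner vertex pays \<open>2 ^ j\<close> to exactly one of the two
    objectives; the 2 is the direct arc, counted in both.\<close>
  have "?f n 1 S + ?f n 2 S = of_nat (2 + (\<Sum>j<n. 2 ^ j))"
    if "S \<in> feasible min_st_cut (hard_cut_network n)" for S
  proof -
    have "(\<Sum>j<n. if (j \<in> S) = odd (1::nat) then 2 ^ j else 0) + (\<Sum>j<n. if (j \<in> S) = odd (2::nat) then 2 ^ j else 0)
        = (\<Sum>j<n. 2 ^ j :: nat)"
      unfolding sum.distrib[symmetric] by (intro sum.cong) auto
    then show ?thesis
      unfolding objective_hard_cut[OF that] of_nat_add[symmetric] by simp
  qed
  then show "\<exists>x\<in>feasible min_st_cut (hard_cut_network n). ?f n 1 x = of_nat (1 + set_encode A) \<and>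
      (\<forall>y\<in>feasible min_st_cut (hard_cut_network n). ?f n 1 x + ?f n 2 x \<le> ?f n 1 y + ?f n 2 y)"
    by (intro bexI[OF _ feas] conjI ballI val) (simp only: feas order_refl)
qed

lemma hard_cut_family: "instance_family min_st_cut p hard_cut_network"
proof (rule instance_familyI)
  have "pair_digraph (fan n)" for n
    by unfold_locales (auto simp: fan_def)
  moreover have "net_coeff (hard_cut_network n) i e \<ge> 0" for n i e
    by (cases e) (simp add: hard_cut_network_def)
  ultimately show "hard_cut_network n \<in> instances min_st_cut p" for n
    by (simp add: min_st_cut_def networks_def nonneg_coeffs_def)
      (simp add: hard_cut_network_def fan_def)
  show "n \<le> enc_size min_st_cut p (hard_cut_network n)" for n
    by (simp add: min_st_cut_def network_size_def hard_cut_network_def fan_def)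
  show "0 < objective min_st_cut (hard_cut_network n) i S"
    if "S \<in> feasible min_st_cut (hard_cut_network n)" for n i S
    unfolding objective_hard_cut[OF that] by (simp only: of_nat_0_less_iff)
qed

section \<open>Minimum spanning tree\<close>

text \<open>
  Two hubs \<open>N\<close> and \<open>N + 1\<close> are joined by an edge of cost 0 and share the leaves \<open>0, \<dots>, N - 1\<close>.  Both edges
  at leaf \<open>j\<close> have total cost \<open>2 + 2 ^ j\<close> over an odd and an even objective, and connectivity forces
  at least one of them into the tree, which bounds the total cost without counting tree edges.
\<close>

definition hub_edges :: "nat \<Rightarrow> nat set set" where
  "hub_edges N = insert {N, N + 1} ((\<lambda>j. {j, N}) ` {..<N} \<union> (\<lambda>j. {j, N + 1}) ` {..<N})"

text \<open>Odd objectives put the surcharge on the edge to hub \<open>n + 1\<close>, even ones on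
  the edge to \<open>n + 2\<close>. Hubs exceed all leaves, so \<open>Min e\<close> is the leaf.
  With \<open>n + 1\<close> leaves there is always one, without which the free hub edge would give
  value 0.\<close>

definition hard_mst :: "nat \<Rightarrow> edge_weighted_graph" where
  "hard_mst n = \<lparr> ew_verts = {..n + 2}, ew_edges = hub_edges (n + 1),
     ew_cost = (\<lambda>i e. of_nat (if e = {n + 1, n + 2} then 0
       else if (n + 1 \<in> e) = odd i then 1 + 2 ^ Min e else 1)) \<rparr>"

definition double_star :: "nat \<Rightarrow> nat set \<Rightarrow> nat set set" where
  "double_star N A = insert {N, N + 1} ((\<lambda>j. {j, if j \<in> A then N else N + 1}) ` {..<N})"

lemma connects_double_star: "connects {..N + 1} (double_star N A)"
proof -
  define R where "R = {(x, y). {x, y} \<in> double_star N A}"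
  have "sym R"
    by (auto simp: R_def sym_def insert_commute)
  have "(N + 1, N) \<in> R"
    by (auto simp: R_def double_star_def insert_commute)
  have "(v, N) \<in> R\<^sup>*" if v: "v \<in> {..N + 1}" for v
  proof -
    consider "v = N" | "v = N + 1" | "v < N"
      using v by force
    then show ?thesis
    proof cases
      case 3
      then have "(v, if v \<in> A then N else N + 1) \<in> R"
        by (auto simp: R_def double_star_def)
      then show ?thesis
        using \<open>(N + 1, N) \<in> R\<close> by (auto split: if_splits intro: rtrancl_trans)
    qed (use \<open>(N + 1, N) \<in> R\<close> in auto)
  qed
  then have "(u, v) \<in> R\<^sup>*" if "u \<in> {..N + 1}" "v \<in> {..N + 1}" for u v
    using that sym_rtrancl[OF \<open>sym R\<close>] by (meson rtrancl_trans symD)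
  then show ?thesis
    by (simp add: connects_def R_def)
qed

lemma double_star_leaf:
  assumes "{v, u} \<in> double_star N A"
  shows "v \<in> {N, N + 1} \<or> u = (if v \<in> A then N else N + 1)"
proof -
  consider "{v, u} = {N, N + 1}" | j where "{v, u} = {j, if j \<in> A then N else N + 1}"
    using assms unfolding double_star_def by blast
  then show ?thesis
    by cases (auto simp: doubleton_eq_iff)
qed

text \<open>The cyclic predecessor and successor of a position are different once there are at least
  three positions.\<close>

lemma cycle_edges_two_neighbours:
  assumes "distinct vs" "length vs \<ge> 3" "v \<in> set vs"
  obtains u w where "{v, u} \<in> cycle_edges vs" "{v, w} \<in> cycle_edges vs" "u \<noteq> w"
proof -
  let ?L = "length vs"
  obtain i where i: "i < ?L" "v = vs ! i"
    using assms(3) by (auto simp: in_set_conv_nth)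
  \<comment> \<open>The cyclic predecessor of \<open>i\<close>; at 0 it wraps around to the last
    position.\<close>
  define k where "k = (if i = 0 then ?L - 1 else i - 1)"
  have k: "k < ?L" "Suc k mod ?L = i" "k \<noteq> Suc i mod ?L"
    using i(1) assms(2) by (auto simp: k_def mod_Suc)
  have "Suc i mod ?L < ?L"
    using i(1) by (intro mod_less_divisor) auto
  then have "vs ! (Suc i mod ?L) \<noteq> vs ! k"
    using k assms(1) by (simp add: nth_eq_iff_index_eq)
  moreover have "{v, vs ! (Suc i mod ?L)} \<in> cycle_edges vs"
    using i by (auto simp: cycle_edges_def)
  moreover have "{v, vs ! k} \<in> cycle_edges vs"
    using i k by (auto simp: cycle_edges_def insert_commute)
  ultimately show ?thesis
    using that by blast
qed

text \<open>A cycle visits only vertices of degree at least two, so it would have to live on the two hubs.\<close>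

lemma acyclic_double_star: "acyclic_edges (double_star N A)"
  unfolding acyclic_edges_def
proof (intro notI, elim exE conjE)
  fix vs
  assume vs: "3 \<le> length vs" "distinct vs" "cycle_edges vs \<subseteq> double_star N A"
  have "v \<in> {N, N + 1}" if v: "v \<in> set vs" for v
  proof -
    obtain u w where uw: "{v, u} \<in> cycle_edges vs" "{v, w} \<in> cycle_edges vs" "u \<noteq> w"
      using vs(2,1) v by (rule cycle_edges_two_neighbours)
    have "v \<in> {N, N + 1} \<or> x = (if v \<in> A then N else N + 1)" if "{v, x} \<in> cycle_edges vs" for x
      using subsetD[OF vs(3) that] by (rule double_star_leaf)
    from this[OF uw(1)] this[OF uw(2)] uw(3) show ?thesis
      by metis
  qed
  then have "card (set vs) \<le> card {N, N + 1}"
    by (intro card_mono) auto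
  then show False
    using vs(1) distinct_card[OF vs(2)] by simp
qed

lemma feasible_hard_mst:
  "T \<in> feasible minimum_spanning_tree (hard_mst n) \<longleftrightarrow>
     T \<subseteq> hub_edges (n + 1) \<and> connects {..n + 2} T \<and> acyclic_edges T"
  by (simp add: minimum_spanning_tree_def hard_mst_def)

lemma objective_hard_mst:
  "objective minimum_spanning_tree (hard_mst n) i T = sum (ew_cost (hard_mst n) i) T"
  by (simp add: minimum_spanning_tree_def)

lemma finite_hub_edges: "finite (hub_edges N)"
  by (simp add: hub_edges_def)

lemma double_star_feasible:
  "double_star (n + 1) A \<in> feasible minimum_spanning_tree (hard_mst n)"
proof -
  have "{j, if j \<in> A then N else N + 1} \<in> (\<lambda>j. {j, N}) ` {..<N} \<union> (\<lambda>j. {j, N + 1}) ` {..<N}"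
    if "j < N" for j N
    using that by (cases "j \<in> A") auto
  then have "double_star (n + 1) A \<subseteq> hub_edges (n + 1)"
    unfolding double_star_def hub_edges_def by (intro insert_mono image_subsetI) (simp only: lessThan_iff)
  then show ?thesis
    using connects_double_star[of "n + 1" A] acyclic_double_star by (simp add: feasible_hard_mst)
qed

lemma hard_mst_cost_nonneg: "0 \<le> ew_cost (hard_mst n) i e"
  by (simp add: hard_mst_def)

lemma hard_mst_cost_leaf:
  assumes "j < n + 1"
  shows "ew_cost (hard_mst n) i {j, n + 1} = (if odd i then 1 + 2 ^ j else 1)"
    and "ew_cost (hard_mst n) i {j, n + 2} = (if odd i then 1 else 1 + 2 ^ j)"
  using assms by (auto simp: hard_mst_def doubleton_eq_iff)

text \<open>Connectivity gives a walk from leaf \<open>j\<close> to hub \<open>n + 1\<close>; its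
  first edge can only lead to a hub.\<close>

lemma leaf_edges:
  assumes "T \<in> feasible minimum_spanning_tree (hard_mst n)"
  obtains h where "\<And>j. j < n + 1 \<Longrightarrow> {j, h j} \<in> T \<and> h j \<in> {n + 1, n + 2}"
proof -
  have "\<exists>y. {j, y} \<in> T \<and> y \<in> {n + 1, n + 2}" if j: "j < n + 1" for j
  proof -
    have "(j, n + 1) \<in> {(x, y). {x, y} \<in> T}\<^sup>*"
      using assms j by (auto simp: feasible_hard_mst connects_def)
    then obtain y where y: "{j, y} \<in> T"
      using j by (cases rule: converse_rtranclE) auto
    then have "{j, y} \<in> hub_edges (n + 1)"
      using assms by (auto simp: feasible_hard_mst)
    then have "y \<in> {n + 1, n + 2}"
      using j by (auto simp: hub_edges_def doubleton_eq_iff)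
    with y show ?thesis
      by blast
  qed
  then show ?thesis
    using that by metis
qed

text \<open>Leaves are smaller than hubs, so an edge determines its leaf and no two indices share an
  edge.\<close>

lemma sum_leaf_edges:
  fixes h :: "nat \<Rightarrow> nat"
  assumes "\<And>j. j < n + 1 \<Longrightarrow> h j \<in> {n + 1, n + 2}"
  shows "sum c ((\<lambda>j. {j, h j}) ` {..<n + 1}) = (\<Sum>j<n + 1. c {j, h j})"
proof (subst sum.reindex)
  show "inj_on (\<lambda>j. {j, h j}) {..<n + 1}"
  proof (rule inj_onI)
    fix i j
    assume "i \<in> {..<n + 1}" "j \<in> {..<n + 1}" "{i, h i} = {j, h j}"
    then show "i = j"
      using assms[of i] assms[of j] by (auto simp: doubleton_eq_iff)
  qed
qed simp

text \<open>The remaining edges of \<open>T\<close> cost nothing negative. With \<open>c\<close> the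
  combined cost this bounds \<open>f + g\<close> from below; with a single objective it yields
  positivity.\<close>

lemma hard_mst_ge_leaf_edges:
  assumes T: "T \<in> feasible minimum_spanning_tree (hard_mst n)"
    and c: "\<And>e. e \<in> T \<Longrightarrow> (0::rat) \<le> c e"
    and h: "\<And>j. j < n + 1 \<Longrightarrow> {j, h j} \<in> T \<and> h j \<in> {n + 1, n + 2}"
  shows "(\<Sum>j<n + 1. c {j, h j}) \<le> sum c T"
proof -
  have "finite T"
    using T finite_subset[OF _ finite_hub_edges] by (auto simp: feasible_hard_mst)
  then have "sum c ((\<lambda>j. {j, h j}) ` {..<n + 1}) \<le> sum c T"
    using h c by (intro sum_mono2) auto
  then show ?thesis
    using h by (subst (asm) sum_leaf_edges) auto
qed

lemma sum_double_star:
  "sum (ew_cost (hard_mst n) i) (double_star (n + 1) A)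
     = (\<Sum>j<n + 1. if (j \<in> A) = odd i then 1 + 2 ^ j else 1)"
proof -
  define h where "h j = (if j \<in> A then n + 1 else n + 2)" for j
  have "{n + 1, n + 2} \<noteq> {j, h j}" if "j < n + 1" for j
    using that by (simp add: doubleton_eq_iff)
  then have "{n + 1, n + 2} \<notin> (\<lambda>j. {j, h j}) ` {..<n + 1}"
    by blast
  moreover have "double_star (n + 1) A = insert {n + 1, n + 2} ((\<lambda>j. {j, h j}) ` {..<n + 1})"
    by (simp only: double_star_def h_def add.assoc one_add_one)
  ultimately have "sum (ew_cost (hard_mst n) i) (double_star (n + 1) A)
      = ew_cost (hard_mst n) i {n + 1, n + 2} + sum (ew_cost (hard_mst n) i) ((\<lambda>j. {j, h j}) ` {..<n + 1})"
    by simp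
  also have "\<dots> = (\<Sum>j<n + 1. ew_cost (hard_mst n) i {j, h j})"
    by (subst sum_leaf_edges) (auto simp: h_def hard_mst_def)
  also have "\<dots> = (\<Sum>j<n + 1. if (j \<in> A) = odd i then 1 + 2 ^ j else 1)"
    by (intro sum.cong refl) (auto simp only: h_def hard_mst_cost_leaf lessThan_iff split: if_splits)
  finally show ?thesis .
qed

lemma hard_mst_size:
  "enc_size minimum_spanning_tree p (hard_mst n) \<le> (6 + p * 3 * (2 + 2)) * (n + 1) ^ 3"
proof -
  have "card (hub_edges (n + 1)) \<le> Suc (card ((\<lambda>j. {j, n + 1}) ` {..<n + 1} \<union> (\<lambda>j. {j, n + 2}) ` {..<n + 1}))"
    unfolding hub_edges_def by (simp add: card_insert_if)
  also have "card ((\<lambda>j. {j, n + 1}) ` {..<n + 1} \<union> (\<lambda>j. {j, n + 2}) ` {..<n + 1})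
      \<le> card {..<n + 1} + card {..<n + 1}"
    by (rule order_trans[OF card_Un_le add_mono]) (rule card_image_le; simp)+
  finally have edges: "card (hub_edges (n + 1)) \<le> 3 * (n + 1)"
    by simp
  have "n + 1 \<le> (n + 1) ^ 3" "n + 1 \<le> (n + 1) ^ 2"
    by (rule self_le_power; simp)+
  moreover have "n + 3 + e \<le> 6 * m" "e \<le> 3 * m" if "e \<le> 3 * (n + 1)" "n + 1 \<le> m" for e m :: nat
    using that by simp_all
  ultimately have le: "n + 3 + card (hub_edges (n + 1)) \<le> 6 * (n + 1) ^ 3"
    and "card (hub_edges (n + 1)) \<le> 3 * (n + 1) ^ 2"
    using edges by blast+
  have "coeff_bits p (hub_edges (n + 1)) (ew_cost (hard_mst n)) \<le> p * 3 * (2 + 2) * (n + 1) ^ 3"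
  proof (rule coeff_bits_cubic[OF _ \<open>card (hub_edges (n + 1)) \<le> 3 * (n + 1) ^ 2\<close>])
    fix i :: nat and e
    assume "e \<in> hub_edges (n + 1)"
    then have "Min e \<le> n + 1"
      by (auto simp: hub_edges_def)
    define m :: nat where "m = (if e = {n + 1, n + 2} then 0
      else if (n + 1 \<in> e) = odd i then 1 + 2 ^ Min e else 1)"
    have "m \<le> 1 + 2 ^ (n + 1)"
      using power_increasing[OF \<open>Min e \<le> n + 1\<close>, of "2::nat"] by (auto simp: m_def)
    also have "\<dots> < 2 ^ (n + 1) + 2 ^ (n + 1)"
      by (rule add_strict_right_mono) (rule one_less_power; simp)
    also have "\<dots> = 2 ^ (n + 2)"
      by simp
    finally have "m < 2 ^ (n + 2)" .
    then have "m < 2 ^ (2 * (n + 1))"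
      by (rule less_le_trans) (rule power_increasing; simp)
    moreover have "ew_cost (hard_mst n) i e = of_nat m"
      by (simp add: hard_mst_def m_def)
    ultimately show "\<exists>m < 2 ^ (2 * (n + 1)). ew_cost (hard_mst n) i e = of_nat m"
      by blast
  qed
  with le show ?thesis
    by (simp add: minimum_spanning_tree_def hard_mst_def distrib_right)
qed

lemma hard_mst_not_approx:
  assumes "\<lceil>real p / 2\<rceil> < int k"
  shows "\<not> admits_poly_card_approx minimum_spanning_tree p k \<epsilon> hard_mst"
proof (rule hard_family_Minimize[OF _ assms hard_mst_size])
  show "sense minimum_spanning_tree = Minimize"
    by (simp add: minimum_spanning_tree_def)
  let ?f = "\<lambda>n i. sum (ew_cost (hard_mst n) i)"
  show "objective minimum_spanning_tree (hard_mst n) i = (if odd i then ?f n 1 else ?f n 2)" for n i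
  proof -
    have "ew_cost (hard_mst n) i = ew_cost (hard_mst n) (if odd i then 1 else 2)"
      by (auto simp: hard_mst_def fun_eq_iff)
    then show ?thesis
      by (cases "odd i") (simp_all add: objective_hard_mst fun_eq_iff)
  qed
  show "inj_on (\<lambda>A. n + 1 + set_encode A) (Pow {..<n})" for n
    by (rule inj_on_set_encode_shift)
  fix n :: nat and A
  assume A: "A \<subseteq> {..<n}"
  let ?T = "double_star (n + 1) A"
  have "(\<Sum>j<n + 1. if j \<in> A then 1 + 2 ^ j else (1::rat)) = (\<Sum>j<n + 1. 1 + (if j \<in> A then 2 ^ j else 0))"
    by (intro sum.cong) auto
  also have "\<dots> = of_nat (n + 1) + (\<Sum>j<n + 1. if j \<in> A then 2 ^ j else 0)"
    by (simp only: sum.distrib) simp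
  also have "(\<Sum>j<n + 1. if j \<in> A then 2 ^ j else 0) = (\<Sum>j\<in>A. (2::rat) ^ j)"
    using A by (subst sum.inter_restrict[symmetric]) (auto intro!: sum.cong)
  also have "\<dots> = of_nat (set_encode A)"
    by (simp add: set_encode_def)
  finally have val: "?f n 1 ?T = of_nat (n + 1 + set_encode A)"
    by (simp only: sum_double_star odd_one simp_thms of_nat_add)
  \<comment> \<open>The hub edge is free, so the double star attains the bound that the leaves
    impose on every spanning tree.\<close>
  have total: "?f n 1 ?T + ?f n 2 ?T = (\<Sum>j<n + 1. 2 + 2 ^ j)"
    unfolding sum_double_star sum.distrib[symmetric] by (intro sum.cong) auto
  have "(\<Sum>j<n + 1. 2 + 2 ^ j) \<le> ?f n 1 T + ?f n 2 T"
    if T: "T \<in> feasible minimum_spanning_tree (hard_mst n)" for T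
  proof -
    obtain h where h: "\<And>j. j < n + 1 \<Longrightarrow> {j, h j} \<in> T \<and> h j \<in> {n + 1, n + 2}"
      using leaf_edges[OF T] by blast
    define c where "c e = ew_cost (hard_mst n) 1 e + ew_cost (hard_mst n) 2 e" for e
    have "(\<Sum>j<n + 1. 2 + 2 ^ j) = (\<Sum>j<n + 1. c {j, h j})"
    proof (intro sum.cong refl)
      fix j
      assume "j \<in> {..<n + 1}"
      then show "2 + 2 ^ j = c {j, h j}"
        using h[of j] hard_mst_cost_leaf[of j n] by (auto simp: c_def)
    qed
    also have "\<dots> \<le> sum c T"
      using T h by (intro hard_mst_ge_leaf_edges) (auto simp: c_def intro: add_nonneg_nonneg hard_mst_cost_nonneg)
    finally show ?thesis
      by (simp add: c_def sum.distrib)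
  qed
  then show "\<exists>x\<in>feasible minimum_spanning_tree (hard_mst n). ?f n 1 x = of_nat (n + 1 + set_encode A) \<and>
      (\<forall>y\<in>feasible minimum_spanning_tree (hard_mst n). ?f n 1 x + ?f n 2 x \<le> ?f n 1 y + ?f n 2 y)"
    by (intro bexI[OF _ double_star_feasible[of n A]] conjI ballI val) (simp only: total)
qed

lemma hard_mst_family: "instance_family minimum_spanning_tree p hard_mst"
proof (rule instance_familyI)
  have "hub_edges (n + 1) \<subseteq> all_edges {..n + 2}" for n
    by (auto simp: hub_edges_def all_edges_def)
  then show "hard_mst n \<in> instances minimum_spanning_tree p" for n
    by (simp add: minimum_spanning_tree_def nonneg_coeffs_def hard_mst_cost_nonneg)
      (simp add: hard_mst_def)
  show "n \<le> enc_size minimum_spanning_tree p (hard_mst n)" for n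
    by (simp add: minimum_spanning_tree_def hard_mst_def)
  show "0 < objective minimum_spanning_tree (hard_mst n) i T"
    if T: "T \<in> feasible minimum_spanning_tree (hard_mst n)" for n i T
  proof -
    obtain h where h: "\<And>j. j < n + 1 \<Longrightarrow> {j, h j} \<in> T \<and> h j \<in> {n + 1, n + 2}"
      using leaf_edges[OF T] by blast
    have "0 < (\<Sum>j<n + 1. ew_cost (hard_mst n) i {j, h j})"
    proof (rule sum_pos)
      fix j
      assume "j \<in> {..<n + 1}"
      then show "0 < ew_cost (hard_mst n) i {j, h j}"
        using h[of j] hard_mst_cost_leaf[of j n i] add_pos_pos[OF zero_less_one, of "2 ^ j :: rat"]
        by auto
    qed (auto simp: lessThan_Suc)
    also have "\<dots> \<le> objective minimum_spanning_tree (hard_mst n) i T"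
      unfolding objective_hard_mst using T h
      by (intro hard_mst_ge_leaf_edges) (auto intro: hard_mst_cost_nonneg)
    finally show ?thesis .
  qed
qed

section \<open>Traveling salesman\<close>

lemma cycle_edges_conv_image:
  "cycle_edges vs = (\<lambda>i. {vs ! i, vs ! (Suc i mod length vs)}) ` {..<length vs}"
  by (auto simp: cycle_edges_def)

lemma finite_cycle_edges: "finite (cycle_edges vs)"
  by (simp add: cycle_edges_conv_image)

text \<open>Two positions with the same edge are equal or successors of each other, and the latter
  would force length 2. Hence all tours have equally many edges and tie in the total.\<close>

lemma card_cycle_edges:
  assumes "distinct vs" "length vs \<ge> 3"
  shows "card (cycle_edges vs) = length vs"
proof -
  let ?L = "length vs"
  have "i = k" if "i < ?L" "k < ?L"
    "{vs ! i, vs ! (Suc i mod ?L)} = {vs ! k, vs ! (Suc k mod ?L)}" for i k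
  proof -
    have "Suc i mod ?L < ?L" "Suc k mod ?L < ?L"
      using that(1) by (auto intro: mod_less_divisor)
    with that have "i = k \<or> i = Suc k mod ?L \<and> k = Suc i mod ?L"
      using assms(1) by (auto simp: doubleton_eq_iff nth_eq_iff_index_eq)
    then show ?thesis
      using that(1,2) assms(2) by (auto simp: mod_Suc split: if_splits)
  qed
  then show ?thesis
    unfolding cycle_edges_conv_image by (subst card_image) (auto intro!: inj_onI)
qed

text \<open>
  The tour visits, block by block, \<open>3q, 3q + 1, 3q + 2\<close> if \<open>q \<in> A\<close> and \<open>3q, 3q + 2, 3q + 1\<close> otherwise, so that
  it uses the edge \<open>{3q, 3q + 1}\<close> precisely for \<open>q \<in> A\<close>.
\<close>

definition detour :: "nat set \<Rightarrow> nat \<Rightarrow> nat" where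
  "detour A i = (if i mod 3 = 0 \<or> i div 3 \<in> A then i else if i mod 3 = 1 then i + 1 else i - 1)"

lemma detour_simps [simp]:
  "detour A (3 * q) = 3 * q"
  "detour A (Suc (3 * q)) = (if q \<in> A then Suc (3 * q) else Suc (Suc (3 * q)))"
  "detour A (Suc (Suc (3 * q))) = (if q \<in> A then Suc (Suc (3 * q)) else Suc (3 * q))"
proof -
  have "Suc (3 * q) mod 3 = 1" "Suc (3 * q) div 3 = q"
    "Suc (Suc (3 * q)) mod 3 = 2" "Suc (Suc (3 * q)) div 3 = q"
    by presburger+
  then show "detour A (3 * q) = 3 * q"
    "detour A (Suc (3 * q)) = (if q \<in> A then Suc (3 * q) else Suc (Suc (3 * q)))"
    "detour A (Suc (Suc (3 * q))) = (if q \<in> A then Suc (Suc (3 * q)) else Suc (3 * q))"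
    by (simp_all add: detour_def)
qed

lemma mod3_cases:
  fixes i :: nat
  obtains q where "i = 3 * q" | q where "i = Suc (3 * q)" | q where "i = Suc (Suc (3 * q))"
proof -
  have "i = 3 * (i div 3) \<or> i = Suc (3 * (i div 3)) \<or> i = Suc (Suc (3 * (i div 3)))"
    by presburger
  then show ?thesis
    using that by blast
qed

lemma detour_involution [simp]: "detour A (detour A i) = i"
  by (cases i rule: mod3_cases) simp_all

lemma detour_less:
  assumes "i < 3 * N"
  shows "detour A i < 3 * N"
proof -
  have "Suc (Suc (3 * q)) < 3 * N" if "Suc (3 * q) < 3 * N" for q
    using that by presburger
  with assms show ?thesis
    by (cases i rule: mod3_cases) auto
qed

text \<open>An involution that maps the segment into itself permutes it.\<close>

lemma detour_image: "detour A ` {..<3 * N} = {..<3 * N}"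
proof
  show "{..<3 * N} \<subseteq> detour A ` {..<3 * N}"
    using detour_less detour_involution by (metis image_eqI lessThan_iff subsetI)
qed (auto intro: detour_less)

definition tour :: "nat \<Rightarrow> nat set \<Rightarrow> nat list" where
  "tour N A = map (detour A) [0..<3 * N]"

lemma distinct_tour: "distinct (tour N A)"
  unfolding tour_def distinct_map by (auto intro: inj_on_inverseI[where g = "detour A"])

lemma set_tour: "set (tour N A) = {..<3 * N}"
  unfolding tour_def set_map set_upt lessThan_atLeast0[symmetric] by (rule detour_image)

text \<open>If \<open>j \<notin> A\<close>, then \<open>3 * j\<close> and \<open>3 * j + 1\<close>
  sit at positions \<open>3 * j\<close> and \<open>3 * j + 2\<close>. These are not cyclically
  adjacent once there are two blocks; in a single triangle they would be.\<close>

lemma marked_edge_in_tour: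
  assumes "N \<ge> 2" "j < N"
  shows "{3 * j, 3 * j + 1} \<in> cycle_edges (tour N A) \<longleftrightarrow> j \<in> A"
proof
  assume "j \<in> A"
  moreover have "Suc (3 * j) < 3 * N"
    using assms(2) by simp
  ultimately show "{3 * j, 3 * j + 1} \<in> cycle_edges (tour N A)"
    unfolding cycle_edges_conv_image by (intro image_eqI[of _ _ "3 * j"]) (auto simp: tour_def)
next
  assume "{3 * j, 3 * j + 1} \<in> cycle_edges (tour N A)"
  then obtain i where i: "i < 3 * N" "{3 * j, 3 * j + 1} = {tour N A ! i, tour N A ! (Suc i mod (3 * N))}"
    unfolding cycle_edges_conv_image by (auto simp: tour_def)
  have "Suc i mod (3 * N) < 3 * N"
    using assms by simp
  with i have "{3 * j, 3 * j + 1} = {detour A i, detour A (Suc i mod (3 * N))}"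
    by (simp add: tour_def)
  \<comment> \<open>Applying the involution to both sides turns the visited vertices back into tour
    positions.\<close>
  then have "detour A ` {3 * j, 3 * j + 1} = detour A ` {detour A i, detour A (Suc i mod (3 * N))}"
    by simp
  then have eq: "{3 * j, detour A (3 * j + 1)} = {i, Suc i mod (3 * N)}"
    by (simp only: image_insert image_empty detour_involution detour_simps(1))
  show "j \<in> A"
  proof (rule ccontr)
    assume "j \<notin> A"
    with eq have "{3 * j, Suc (Suc (3 * j))} = {i, Suc i mod (3 * N)}"
      by simp
    then show False
      using assms i(1) by (auto simp: doubleton_eq_iff mod_Suc split: if_splits)
  qed
qed

text \<open>The offset 2 guarantees at least two blocks, so that marked edges can be
  avoided.\<close>

definition hard_tsp :: "nat \<Rightarrow> tsp_instance" where
  "hard_tsp n = \<lparr> tsp_n = 3 * (n + 2), tsp_cost = opposed_cost (n + 2) (\<lambda>j. {3 * j, 3 * j + 1}) \<rparr>"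

lemma feasible_hard_tsp:
  "feasible traveling_salesman (hard_tsp n) =
     {cycle_edges vs | vs. distinct vs \<and> set vs = {..<3 * (n + 2)}}"
  by (simp add: traveling_salesman_def hard_tsp_def)

lemma tour_feasible: "cycle_edges (tour (n + 2) A) \<in> feasible traveling_salesman (hard_tsp n)"
  unfolding feasible_hard_tsp using distinct_tour set_tour by blast

lemma card_hard_tsp:
  assumes "T \<in> feasible traveling_salesman (hard_tsp n)"
  shows "finite T" "card T = 3 * (n + 2)"
proof -
  obtain vs where vs: "T = cycle_edges vs" "distinct vs" "set vs = {..<3 * (n + 2)}"
    using assms unfolding feasible_hard_tsp by blast
  have "length vs = 3 * (n + 2)"
    using distinct_card[OF vs(2)] vs(3) by simp
  then show "finite T" "card T = 3 * (n + 2)"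
    using vs finite_cycle_edges card_cycle_edges by auto
qed

lemma objective_hard_tsp:
  "objective traveling_salesman (hard_tsp n) i T =
     sum (opposed_cost (n + 2) (\<lambda>j. {3 * j, 3 * j + 1}) i) T"
  by (simp add: traveling_salesman_def hard_tsp_def)

lemma hard_tsp_size:
  "enc_size traveling_salesman p (hard_tsp n) \<le> (6 + p * 36 * (3 + 2)) * (n + 1) ^ 3"
proof -
  have "3 * (n + 2) \<le> 6 * (n + 1)"
    by simp
  also have "\<dots> \<le> 6 * (n + 1) ^ 3"
    by (intro mult_left_mono self_le_power) auto
  finally have "3 * (n + 2) \<le> 6 * (n + 1) ^ 3" .
  moreover have "card (all_edges {..<3 * (n + 2)}) \<le> 36 * (n + 1) ^ 2"
  proof -
    have "all_edges {..<3 * (n + 2)} \<subseteq> (\<lambda>(u, v). {u, v}) ` ({..<3 * (n + 2)} \<times> {..<3 * (n + 2)})"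
      by (fastforce simp: all_edges_def card_2_iff)
    then have "card (all_edges {..<3 * (n + 2)}) \<le> card ({..<3 * (n + 2)} \<times> {..<3 * (n + 2)})"
      by (rule surj_card_le[rotated]) simp
    also have "\<dots> \<le> (6 * (n + 1)) ^ 2"
      unfolding card_cartesian_product card_lessThan power2_eq_square by (rule mult_mono) auto
    finally show ?thesis
      by (simp only: power_mult_distrib) simp
  qed
  then have "coeff_bits p (all_edges {..<3 * (n + 2)}) (opposed_cost (n + 2) (\<lambda>j. {3 * j, 3 * j + 1}))
      \<le> p * 36 * (3 + 2) * (n + 1) ^ 3"
    by (rule coeff_bits_opposed_cost[rotated]) simp
  ultimately have "3 * (n + 2) + coeff_bits p (all_edges {..<3 * (n + 2)})
      (opposed_cost (n + 2) (\<lambda>j. {3 * j, 3 * j + 1})) \<le> (6 + p * 36 * (3 + 2)) * (n + 1) ^ 3"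
    unfolding distrib_right by (rule add_mono)
  then show ?thesis
    by (simp add: traveling_salesman_def hard_tsp_def)
qed

lemma hard_tsp_not_approx:
  assumes "\<lceil>real p / 2\<rceil> < int k"
  shows "\<not> admits_poly_card_approx traveling_salesman p k \<epsilon> hard_tsp"
proof -
  let ?f = "\<lambda>n i. sum (opposed_cost (n + 2) (\<lambda>j. {3 * j, 3 * j + 1}) i)"
  show ?thesis
  proof (rule hard_family_Minimize[OF _ assms hard_tsp_size])
    show "sense traveling_salesman = Minimize"
      by (simp add: traveling_salesman_def)
    show "objective traveling_salesman (hard_tsp n) i = (if odd i then ?f n 1 else ?f n 2)" for n i
      by (rule ext) (auto simp only: objective_hard_tsp sum_opposed_cost_parity[of _ _ i] split: if_splits)
    show "inj_on (\<lambda>A. 3 * (n + 2) + set_encode A) (Pow {..<n})" for n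
      by (rule inj_on_set_encode_shift)
  next
    fix n :: nat and A
    assume A: "A \<subseteq> {..<n}"
    let ?T = "cycle_edges (tour (n + 2) A)"
    have "{j. j < n + 2 \<and> {3 * j, 3 * j + 1} \<in> ?T} = A"
      using A marked_edge_in_tour[of "n + 2" _ A] by auto
    then have val: "?f n 1 ?T = of_nat (3 * (n + 2) + set_encode A)"
      by (subst sum_opposed_cost_1) (simp_all only: card_hard_tsp[OF tour_feasible])
    have "?f n 1 T + ?f n 2 T = of_nat (3 * (n + 2) * (2 ^ (n + 2) + 1))"
      if "T \<in> feasible traveling_salesman (hard_tsp n)" for T
      unfolding sum_opposed_cost_total card_hard_tsp[OF that] ..
    then show "\<exists>x\<in>feasible traveling_salesman (hard_tsp n). ?f n 1 x = of_nat (3 * (n + 2) + set_encode A) \<and>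
      (\<forall>y\<in>feasible traveling_salesman (hard_tsp n). ?f n 1 x + ?f n 2 x \<le> ?f n 1 y + ?f n 2 y)"
      by (intro bexI[OF _ tour_feasible[of n A]] conjI ballI val) (simp only: tour_feasible order_refl)
  qed
qed

lemma hard_tsp_family: "instance_family traveling_salesman p hard_tsp"
proof (rule instance_familyI)
  show "hard_tsp n \<in> instances traveling_salesman p" for n
    by (simp add: traveling_salesman_def hard_tsp_def nonneg_coeffs_def opposed_cost_pos less_imp_le)
  show "n \<le> enc_size traveling_salesman p (hard_tsp n)" for n
    by (simp add: traveling_salesman_def hard_tsp_def)
  show "0 < objective traveling_salesman (hard_tsp n) i T"
    if "T \<in> feasible traveling_salesman (hard_tsp n)" for n i T
    unfolding objective_hard_tsp using card_hard_tsp[OF that]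
    by (intro sum_opposed_cost_pos) auto
qed

theorem theorem3p4:
  fixes p :: nat
  assumes "p \<ge> 2"
  shows "(\<exists>I. instance_family shortest_path p I \<and>
          (\<forall>k \<epsilon>. \<lceil>real p / 2\<rceil> < int k \<and> k \<le> p \<and> \<epsilon> > 0 \<longrightarrow>
             \<not> admits_poly_card_approx shortest_path p k \<epsilon> I)) \<and>
         (\<exists>I. instance_family minimum_spanning_tree p I \<and>
          (\<forall>k \<epsilon>. \<lceil>real p / 2\<rceil> < int k \<and> k \<le> p \<and> \<epsilon> > 0 \<longrightarrow>
             \<not> admits_poly_card_approx minimum_spanning_tree p k \<epsilon> I)) \<and>
         (\<exists>I. instance_family assignment p I \<and>
          (\<forall>k \<epsilon>. \<lceil>real p / 2\<rceil> < int k \<and> k \<le> p \<and> \<epsilon> > 0 \<longrightarrow>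
             \<not> admits_poly_card_approx assignment p k \<epsilon> I)) \<and>
         (\<exists>I. instance_family min_st_cut p I \<and>
          (\<forall>k \<epsilon>. \<lceil>real p / 2\<rceil> < int k \<and> k \<le> p \<and> \<epsilon> > 0 \<longrightarrow>
             \<not> admits_poly_card_approx min_st_cut p k \<epsilon> I)) \<and>
         (\<exists>I. instance_family nonempty_knapsack p I \<and>
          (\<forall>k \<epsilon>. \<lceil>real p / 2\<rceil> < int k \<and> k \<le> p \<and> \<epsilon> > 0 \<longrightarrow>
             \<not> admits_poly_card_approx knapsack p k \<epsilon> I \<and>
             \<not> admits_poly_card_approx nonempty_knapsack p k \<epsilon> I)) \<and>
         (\<exists>I. instance_family traveling_salesman p I \<and>
          (\<forall>k \<epsilon>. \<lceil>real p / 2\<rceil> < int k \<and> k \<le> p \<and> \<epsilon> > 0 \<longrightarrow>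
             \<not> admits_poly_card_approx traveling_salesman p k \<epsilon> I))"
proof (intro conjI)
  show "\<exists>I. instance_family shortest_path p I \<and>
      (\<forall>k \<epsilon>. \<lceil>real p / 2\<rceil> < int k \<and> k \<le> p \<and> \<epsilon> > 0 \<longrightarrow> \<not> admits_poly_card_approx shortest_path p k \<epsilon> I)"
    using hard_path_family hard_path_not_approx by blast
  show "\<exists>I. instance_family minimum_spanning_tree p I \<and>
      (\<forall>k \<epsilon>. \<lceil>real p / 2\<rceil> < int k \<and> k \<le> p \<and> \<epsilon> > 0 \<longrightarrow> \<not> admits_poly_card_approx minimum_spanning_tree p k \<epsilon> I)"
    using hard_mst_family hard_mst_not_approx by blast
  show "\<exists>I. instance_family assignment p I \<and>
      (\<forall>k \<epsilon>. \<lceil>real p / 2\<rceil> < int k \<and> k \<le> p \<and> \<epsilon> > 0 \<longrightarrow> \<not> admits_poly_card_approx assignment p k \<epsilon> I)"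
    using hard_assignment_family hard_assignment_not_approx by blast
  show "\<exists>I. instance_family min_st_cut p I \<and>
      (\<forall>k \<epsilon>. \<lceil>real p / 2\<rceil> < int k \<and> k \<le> p \<and> \<epsilon> > 0 \<longrightarrow> \<not> admits_poly_card_approx min_st_cut p k \<epsilon> I)"
    using hard_cut_family hard_cut_not_approx by blast
  have "\<not> admits_poly_card_approx knapsack p k \<epsilon> hard_knapsack"
    and "\<not> admits_poly_card_approx nonempty_knapsack p k \<epsilon> hard_knapsack"
    if "\<lceil>real p / 2\<rceil> < int k" for k \<epsilon>
    using that by (rule hard_knapsack_not_approx; auto simp: nonempty_knapsack_def knapsack_def)+
  then show "\<exists>I. instance_family nonempty_knapsack p I \<and>
      (\<forall>k \<epsilon>. \<lceil>real p / 2\<rceil> < int k \<and> k \<le> p \<and> \<epsilon> > 0 \<longrightarrow>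
        \<not> admits_poly_card_approx knapsack p k \<epsilon> I \<and> \<not> admits_poly_card_approx nonempty_knapsack p k \<epsilon> I)"
    using hard_knapsack_family by blast
  show "\<exists>I. instance_family traveling_salesman p I \<and>
      (\<forall>k \<epsilon>. \<lceil>real p / 2\<rceil> < int k \<and> k \<le> p \<and> \<epsilon> > 0 \<longrightarrow> \<not> admits_poly_card_approx traveling_salesman p k \<epsilon> I)"
    using hard_tsp_family hard_tsp_not_approx by blast
qed

end
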